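(* (i) Let $\Phi:\mathcal{K}^2\to\mathcal{K}^2$ be a Minkowski endomorphism. Then $\Phi$ satisfies (VC) if and only if there are $g\in\mathrm{SO}(2)$ and real numbers $a,b\geq 0$ with $a+b>0$ such that $$\Phi(K)=a\,g(K-\mathrm{st}(K))+b\,g(-K+\mathrm{st}(K))\quad\text{for all }K\in\mathcal{K}^2.$$ (ii) Let $\Phi:\mathcal{K}^2\to\mathcal{K}^2$ be a Minkowski endomorphism such that $\Phi(K)=-\Phi(K)$ for every $K\in\mathcal{K}^2$. Then $\Phi$ satisfies (VC) if and only if there are $\lambda>0$ and $g\in\mathrm{O}(2)$ such that $\Phi(K)=\lambda\,g(DK)$ for every $K\in\mathcal{K}^2$.
   Context: $\mathcal{K}^2$ is the set of (nonempty) compact convex subsets of $\mathbb{R}^2$, with Minkowski addition and the Hausdorff metric; $V_2$ is area. An operator $\Phi:\mathcal{K}^2\to\mathcal{K}^2$ is a Minkowski endomorphism if it is continuous (Hausdorff metric), translation invariant ($\Phi(K+t)=\Phi(K)$ for all $t\in\mathbb{R}^2$), Minkowski additive ($\Phi(K+L)=\Phi(K)+\Phi(L)$), and $\mathrm{SO}(2)$-equivariant ($\Phi(gK)=g\Phi(K)$ for all $g\in\mathrm{SO}(2)$). $\Phi$ satisfies (VC) if there are constants $c_\Phi,C_\Phi>0$ such that $c_\Phi V_2(K)\leq V_2(\Phi(K))\leq C_\Phi V_2(K)$ for all $K\in\mathcal{K}^2$. The Steiner point is $\mathrm{st}(K)=\frac{1}{V_2(B^2)}\int_{\mathbb{S}^1}u\,h(K,u)\,du$,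 with $h(K,u)=\max_{x\in K}\langle u,x\rangle$ the support function, $B^2$ the closed unit disc and $du$ arc length. $DK=K+(-K)$ is the difference body. *)

theory Defs
  imports "HOL-Analysis.Analysis"
begin

text \<open>
  The sum \<open>K + L\<close> of two sets is the Minkowski sum of \<open>HOL-Library.Set_Algebras\<close>.
  The reflection of \<open>K\<close> in the origin is written \<open>uminus ` K\<close>, because \<open>- K\<close> denotes the set
  complement and \<open>K - L\<close> the set difference.
  Operators on convex bodies are total functions on sets; only their values on
  \<open>convex_bodies\<close> matter.
\<close>

definition convex_bodies :: "'a::euclidean_space set set" where
  "convex_bodies = {K. K \<noteq> {} \<and> compact K \<and> convex K}"

definition hausdorff_dist :: "'a::metric_space set \<Rightarrow> 'a set \<Rightarrow> real" where
  "hausdorff_dist K L = max (SUP x\<in>K. infdist x L) (SUP y\<in>L. infdist y K)"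

definition hausdorff_continuous ::
    "('a::euclidean_space set \<Rightarrow> 'a set) \<Rightarrow> bool" where
  "hausdorff_continuous \<Phi> \<longleftrightarrow>
     (\<forall>K\<in>convex_bodies. \<forall>\<epsilon>>0. \<exists>\<delta>>0. \<forall>L\<in>convex_bodies.
        hausdorff_dist L K < \<delta> \<longrightarrow> hausdorff_dist (\<Phi> L) (\<Phi> K) < \<epsilon>)"

text \<open>\<open>rotation_matrix\<close> is membership in the special orthogonal group, \<open>orthogonal_matrix\<close>
  membership in the orthogonal group.\<close>

definition minkowski_endomorphism :: "((real^2) set \<Rightarrow> (real^2) set) \<Rightarrow> bool" where
  "minkowski_endomorphism \<Phi> \<longleftrightarrow>
     (\<forall>K\<in>convex_bodies. \<Phi> K \<in> convex_bodies) \<and>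
     hausdorff_continuous \<Phi> \<and>
     (\<forall>K\<in>convex_bodies. \<forall>t. \<Phi> ((\<lambda>x. x + t) ` K) = \<Phi> K) \<and>
     (\<forall>K\<in>convex_bodies. \<forall>L\<in>convex_bodies. \<Phi> (K + L) = \<Phi> K + \<Phi> L) \<and>
     (\<forall>K\<in>convex_bodies. \<forall>g::real^2^2. rotation_matrix g \<longrightarrow>
        \<Phi> ((*v) g ` K) = (*v) g ` \<Phi> K)"

abbreviation area :: "(real^2) set \<Rightarrow> real" where
  "area K \<equiv> measure lebesgue K"

definition volume_comparable :: "((real^2) set \<Rightarrow> (real^2) set) \<Rightarrow> bool" where
  "volume_comparable \<Phi> \<longleftrightarrow>
     (\<exists>c>0. \<exists>C>0. \<forall>K\<in>convex_bodies.
        c * area K \<le> area (\<Phi> K) \<and> area (\<Phi> K) \<le> C * area K)"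

text \<open>The supremum is attained when \<open>K\<close> is compact and nonempty.\<close>

definition support_function :: "'a::euclidean_space set \<Rightarrow> 'a \<Rightarrow> real" where
  "support_function K u = (SUP x\<in>K. u \<bullet> x)"

text \<open>The arc length integral over the unit circle is taken in the arc length parametrisation
  \<open>t \<mapsto> (cos t, sin t)\<close> on \<open>[0, 2\<pi>]\<close>.\<close>

definition circle_point :: "real \<Rightarrow> real^2" where
  "circle_point t = vector [cos t, sin t]"

definition steiner_point :: "(real^2) set \<Rightarrow> real^2" where
  "steiner_point K =
     (1 / area (cball 0 1)) *\<^sub>R
       integral {0..2 * pi} (\<lambda>t. support_function K (circle_point t) *\<^sub>R circle_point t)"

definition difference_body :: "'a::euclidean_space set \<Rightarrow> 'a set" where
  "difference_body K = K + uminus ` K"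

end

theory Submission
  imports Defs
begin

text \<open>
  If \<open>\<Phi>\<close> satisfies (VC), it maps segments to bodies of area zero. By equivariance under the
  half turn these are centred segments, so \<open>\<Phi> [-v, v] = M [-v, v]\<close> for a fixed \<open>M = r g\<close> with
  \<open>r > 0\<close> and \<open>g\<close> a rotation. For a triangle \<open>T\<close> the difference body \<open>T - T\<close> is a sum of three
  segments; hence \<open>\<Phi> T\<close> has the width function of \<open>M T\<close>, which forces
  \<open>\<Phi> T = a M T + (1 - a) (- M T)\<close> up to translation for some \<open>a\<close> in \<open>[0, 1]\<close>.
  Whenever \<open>K \<union> L\<close> is convex, \<open>K + L = (K \<union> L) + (K \<inter> L)\<close>. Cutting a triangle by a cevian
  this shows that \<open>a\<close> does not change when a vertex moves along a side line, so \<open>a\<close> is the same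
  for all triangles; cutting polygons along diagonals extends the formula to polygons, and continuity to
  all bodies. The translation is determined because \<open>\<Phi> K\<close> always has Steiner point \<open>0\<close>.
\<close>

subsection \<open>Convex bodies and support functions\<close>

text \<open>Support functions turn Minkowski sums into sums of functions, so identities between
  bodies can be subtracted, and a translation becomes an added linear functional. "Up to
  translation" therefore means "modulo linear functionals" until the very end.

  The obstacle is the odd part of the support function: images of segments determine widths only,
  and widths do not see it. For a triangle, convexity of the image leaves one free parameter
  \<open>a\<close>, and confines it to \<open>[0, 1]\<close>, which is where the nonnegativity of
  both coefficients comes from. The axioms yield rotations and dilations but no shears, so nothing
  relates the parameters of two triangles of different shape except the cut by a cevian. The lower
  bound in (VC) serves to exclude \<open>r = 0\<close>.

  The converse is an area estimate. For unrelated bodies the area of a sum is not bounded by the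
  areas of the summands; for \<open>a K + b (- K)\<close> it is, because \<open>K\<close> and
  \<open>- K\<close> fit, after translation, into one parallelogram of comparable area.\<close>

lemma convex_bodyD:
  assumes "K \<in> convex_bodies"
  shows "K \<noteq> {}" "compact K" "convex K" "bounded K" "closed K"
  using assms compact_imp_bounded compact_imp_closed by (auto simp: convex_bodies_def)

lemma convex_body_plus:
  assumes "K \<in> convex_bodies" "L \<in> convex_bodies"
  shows "K + L \<in> convex_bodies"
proof -
  have "compact {x + y | x y. x \<in> K \<and> y \<in> L}"
    using assms compact_sums by (auto simp: convex_bodies_def)
  moreover have "{x + y | x y. x \<in> K \<and> y \<in> L} = K + L"
    by (auto simp: set_plus_def)
  moreover have "K + L \<noteq> {}"
    using assms by (auto simp: convex_bodies_def set_plus_def)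
  ultimately show ?thesis
    using assms convex_set_plus by (auto simp: convex_bodies_def)
qed

lemma convex_body_linear_image:
  assumes "K \<in> convex_bodies" "linear f"
  shows "f ` K \<in> convex_bodies"
  using assms convex_linear_image[OF assms(2), of K]
    compact_continuous_image[OF linear_continuous_on[of f K]]
  by (simp add: convex_bodies_def linear_conv_bounded_linear)

lemma convex_body_scaleR:
  "K \<in> convex_bodies \<Longrightarrow> (*\<^sub>R) r ` K \<in> convex_bodies"
  by (rule convex_body_linear_image) simp_all

lemma convex_body_uminus:
  "K \<in> convex_bodies \<Longrightarrow> uminus ` K \<in> convex_bodies"
  by (rule convex_body_linear_image) (simp_all add: linear_uminus)

lemma convex_body_matrix:
  fixes g :: "real^'n^'m"
  shows "K \<in> convex_bodies \<Longrightarrow> (*v) g ` K \<in> convex_bodies"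
  by (rule convex_body_linear_image) simp_all

lemma convex_body_translation:
  "K \<in> convex_bodies \<Longrightarrow> (\<lambda>x. x + t) ` K \<in> convex_bodies"
  using compact_translation[of K t] convex_translation[of K t]
  by (auto simp: convex_bodies_def add.commute[of _ t])

lemma convex_body_hull:
  "finite V \<Longrightarrow> V \<noteq> {} \<Longrightarrow> convex hull V \<in> convex_bodies"
  by (simp add: convex_bodies_def finite_imp_compact_convex_hull)

lemma convex_body_singleton: "{x} \<in> convex_bodies"
  by (simp add: convex_bodies_def)

lemma convex_body_cball: "0 \<le> r \<Longrightarrow> cball x r \<in> convex_bodies"
  by (simp add: convex_bodies_def)

lemma convex_body_segment: "closed_segment x y \<in> convex_bodies"
  by (simp add: convex_bodies_def)

lemmas convex_body_intros [intro, simp] =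
  convex_body_plus convex_body_scaleR convex_body_uminus convex_body_matrix
  convex_body_translation convex_body_hull convex_body_singleton convex_body_cball
  convex_body_segment

section \<open>Calculus of support functions\<close>

lemma bdd_above_inner_image:
  assumes "bounded K"
  shows "bdd_above ((\<bullet>) u ` K)"
  using bounded_linear_image[OF assms bounded_linear_inner_right[of u]]
  by (rule bounded_imp_bdd_above)

lemma inner_le_support:
  assumes "bounded K" "x \<in> K"
  shows "u \<bullet> x \<le> support_function K u"
  unfolding support_function_def
  by (rule cSUP_upper[OF assms(2) bdd_above_inner_image[OF assms(1)]])

lemma support_le:
  assumes "K \<noteq> {}" "\<And>x. x \<in> K \<Longrightarrow> u \<bullet> x \<le> c"
  shows "support_function K u \<le> c"
  unfolding support_function_def using assms by (rule cSUP_least)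

lemma support_eqI:
  assumes "x \<in> K" "\<And>y. y \<in> K \<Longrightarrow> u \<bullet> y \<le> u \<bullet> x"
  shows "support_function K u = u \<bullet> x"
  unfolding support_function_def using assms
  by (intro cSup_eq_maximum) auto

lemma support_attained:
  assumes "K \<in> convex_bodies"
  obtains x where "x \<in> K" "support_function K u = u \<bullet> x"
proof -
  obtain x where x: "x \<in> K" "\<And>y. y \<in> K \<Longrightarrow> u \<bullet> y \<le> u \<bullet> x"
    using continuous_attains_sup[OF convex_bodyD(2,1)[OF assms] continuous_on_inner[OF
        continuous_on_const continuous_on_id]] by blast
  then show thesis
    using support_eqI that by blast
qed

lemma support_plus:
  assumes "K \<in> convex_bodies" "L \<in> convex_bodies"
  shows "support_function (K + L) u = support_function K u + support_function L u"
proof -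
  obtain x where x: "x \<in> K" "support_function K u = u \<bullet> x"
    using support_attained[OF assms(1)] .
  obtain y where y: "y \<in> L" "support_function L u = u \<bullet> y"
    using support_attained[OF assms(2)] .
  have "u \<bullet> z \<le> u \<bullet> (x + y)" if z: "z \<in> K + L" for z
  proof -
    obtain v w where vw: "v \<in> K" "w \<in> L" "z = v + w"
      using z by (auto simp: set_plus_def)
    then show ?thesis
      using inner_le_support[of K v u] inner_le_support[of L w u] x y convex_bodyD[OF assms(1)]
        convex_bodyD[OF assms(2)]
      by (simp add: inner_add_right)
  qed
  moreover have "x + y \<in> K + L"
    using x y by (auto simp: set_plus_def)
  ultimately have "support_function (K + L) u = u \<bullet> (x + y)"
    using support_eqI by metis
  then show ?thesis
    using x y by (simp add: inner_add_right)
qed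

lemma support_translation:
  assumes "K \<in> convex_bodies"
  shows "support_function ((\<lambda>x. x + t) ` K) u = support_function K u + u \<bullet> t"
proof -
  obtain x where x: "x \<in> K" "support_function K u = u \<bullet> x"
    using support_attained[OF assms] .
  have "support_function ((\<lambda>x. x + t) ` K) u = u \<bullet> (x + t)"
    using x inner_le_support[of K _ u] convex_bodyD[OF assms]
    by (intro support_eqI) (auto simp: inner_add_right)
  then show ?thesis
    using x by (simp add: inner_add_right)
qed

lemma support_matrix:
  fixes g :: "real^'n^'m"
  shows "support_function ((*v) g ` K) u = support_function K (transpose g *v u)"
proof -
  have "u \<bullet> (g *v x) = (transpose g *v u) \<bullet> x" for x
    by (simp add: dot_lmul_matrix)
  then show ?thesis
    by (simp only: support_function_def image_image)
qed

lemma support_uminus: "support_function (uminus ` K) u = support_function K (- u)"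
  by (simp add: support_function_def image_image)

lemma support_scaleR: "support_function ((*\<^sub>R) r ` K) u = support_function K (r *\<^sub>R u)"
  by (simp add: support_function_def image_image)

lemma support_homogeneous:
  assumes "K \<in> convex_bodies" "0 \<le> c"
  shows "support_function K (c *\<^sub>R u) = c * support_function K u"
proof -
  obtain x where x: "x \<in> K" "support_function K u = u \<bullet> x"
    using support_attained[OF assms(1)] .
  have "support_function K (c *\<^sub>R u) = (c *\<^sub>R u) \<bullet> x"
    using x inner_le_support[of K _ u] convex_bodyD[OF assms(1)] assms(2)
    by (intro support_eqI) (auto intro!: mult_left_mono)
  then show ?thesis
    using x by simp
qed

lemma support_scaleR_nonneg:
  assumes "K \<in> convex_bodies" "0 \<le> a"
  shows "support_function ((*\<^sub>R) a ` K) u = a * support_function K u"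
  unfolding support_scaleR by (rule support_homogeneous[OF assms])

lemma support_weighted_sum:
  assumes "K \<in> convex_bodies" "L \<in> convex_bodies" "0 \<le> a" "0 \<le> b"
  shows "support_function ((*\<^sub>R) a ` K + (*\<^sub>R) b ` L) u
    = a * support_function K u + b * support_function L u"
  using assms by (simp only: support_plus convex_body_scaleR support_scaleR support_homogeneous)

lemma support_zero: "K \<in> convex_bodies \<Longrightarrow> support_function K 0 = 0"
  using support_homogeneous[of K 0 0] by simp

lemma support_subadditive:
  assumes "K \<in> convex_bodies"
  shows "support_function K (u + v) \<le> support_function K u + support_function K v"
  using convex_bodyD[OF assms] inner_le_support[of K _ u] inner_le_support[of K _ v]
  by (intro support_le) (auto simp: inner_add_left intro!: add_mono)

lemma support_singleton: "support_function {x} u = u \<bullet> x"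
  by (simp add: support_function_def)

lemma support_cball_zero:
  assumes "norm u = 1" "0 \<le> r"
  shows "support_function (cball 0 r) u = r"
proof -
  have "support_function (cball 0 r) u = u \<bullet> (r *\<^sub>R u)"
    using assms norm_cauchy_schwarz[of u]
    by (intro support_eqI) (auto simp: dot_square_norm intro: order_trans)
  then show ?thesis
    using assms by (simp add: dot_square_norm)
qed

lemma support_insert:
  assumes "finite V" "V \<noteq> {}"
  shows "support_function (insert x V) u = max (u \<bullet> x) (support_function V u)"
  using assms by (simp add: support_function_def cSup_eq_Max)

lemma support_convex_hull:
  assumes "finite V" "V \<noteq> {}"
  shows "support_function (convex hull V) u = support_function V u"
proof (rule antisym)
  have "V \<subseteq> {x. u \<bullet> x \<le> support_function V u}"
    using inner_le_support[OF finite_imp_bounded[OF assms(1)]] by auto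
  then have "convex hull V \<subseteq> {x. u \<bullet> x \<le> support_function V u}"
    by (rule hull_minimal) (rule convex_halfspace_le)
  then show "support_function (convex hull V) u \<le> support_function V u"
    using assms by (intro support_le) auto
  show "support_function V u \<le> support_function (convex hull V) u"
    using assms convex_bodyD(4)[OF convex_body_hull[OF assms]]
    by (intro support_le inner_le_support) (auto simp: hull_inc)
qed

lemma support_segment:
  "support_function (closed_segment x y) u = max (u \<bullet> x) (u \<bullet> y)"
  by (simp add: segment_convex_hull support_convex_hull support_insert support_singleton)

lemma support_triangle:
  "support_function (convex hull {x, y, z}) u = max (u \<bullet> x) (max (u \<bullet> y) (u \<bullet> z))"
  by (simp add: support_convex_hull support_insert support_singleton)

text \<open>A point of \<open>K\<close> outside \<open>L\<close> could be strictly separated from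
  \<open>L\<close>; the separating normal would violate the inequality.\<close>

lemma convex_body_subset_of_support:
  assumes "L \<in> convex_bodies" "bounded K" "\<And>u. support_function K u \<le> support_function L u"
  shows "K \<subseteq> L"
proof
  fix x assume x: "x \<in> K"
  show "x \<in> L"
  proof (rule ccontr)
    assume "x \<notin> L"
    then obtain u b where ub: "u \<bullet> x < b" "\<forall>y\<in>L. b < u \<bullet> y"
      using separating_hyperplane_closed_point[of L x] convex_bodyD[OF assms(1)] by blast
    have "support_function L (- u) \<le> - b"
      using ub convex_bodyD[OF assms(1)] by (intro support_le) (auto intro: less_imp_le)
    moreover have "(- u) \<bullet> x \<le> support_function K (- u)"
      using inner_le_support[OF assms(2) x] .
    ultimately show False
      using ub assms(3)[of "- u"] by simp
  qed
qed

lemma convex_body_eqI: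
  assumes "K \<in> convex_bodies" "L \<in> convex_bodies"
    and "\<And>u. support_function K u = support_function L u"
  shows "K = L"
  using assms by (intro subset_antisym convex_body_subset_of_support) (auto simp: convex_bodyD)

section \<open>The Hausdorff metric in terms of support functions\<close>

text \<open>Compactness bounds the distances, so the suprema in \<open>hausdorff_dist\<close> are
  genuine upper bounds and not unspecified values.\<close>

lemma infdist_le_hausdorff_dist:
  assumes K: "K \<in> convex_bodies" and L: "L \<in> convex_bodies"
  shows "x \<in> K \<Longrightarrow> infdist x L \<le> hausdorff_dist K L"
    and "y \<in> L \<Longrightarrow> infdist y K \<le> hausdorff_dist K L"
proof -
  have bdd: "bdd_above ((\<lambda>x. infdist x B) ` A)" if "A \<in> convex_bodies" for A B :: "'a set"
    using that convex_bodyD(2)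
    by (intro bounded_imp_bdd_above compact_imp_bounded compact_continuous_image)
       (auto intro!: continuous_intros)
  show "x \<in> K \<Longrightarrow> infdist x L \<le> hausdorff_dist K L"
    unfolding hausdorff_dist_def using cSUP_upper[OF _ bdd[OF K, of L]]
    by (auto simp: le_max_iff_disj)
  show "y \<in> L \<Longrightarrow> infdist y K \<le> hausdorff_dist K L"
    unfolding hausdorff_dist_def using cSUP_upper[OF _ bdd[OF L, of K]]
    by (auto simp: le_max_iff_disj)
qed

lemma hausdorff_dist_leI:
  assumes "K \<noteq> {}" "L \<noteq> {}"
    and "\<And>x. x \<in> K \<Longrightarrow> infdist x L \<le> e" "\<And>y. y \<in> L \<Longrightarrow> infdist y K \<le> e"
  shows "hausdorff_dist K L \<le> e"
  unfolding hausdorff_dist_def using assms by (auto intro!: cSUP_least)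

lemma support_le_hausdorff_dist:
  assumes K: "K \<in> convex_bodies" and L: "L \<in> convex_bodies"
  shows "\<bar>support_function K u - support_function L u\<bar> \<le> norm u * hausdorff_dist K L"
proof -
  have aux: "support_function A u \<le> support_function B u + norm u * d"
    if A: "A \<in> convex_bodies" and B: "B \<in> convex_bodies"
      and d: "\<And>x. x \<in> A \<Longrightarrow> infdist x B \<le> d" for A B :: "'a set" and d
  proof -
    obtain x where x: "x \<in> A" "support_function A u = u \<bullet> x"
      using support_attained[OF A] .
    obtain y where y: "y \<in> B" "infdist x B = dist x y"
      using infdist_attains_inf[of B x] convex_bodyD[OF B] by auto
    have "u \<bullet> x = u \<bullet> y + u \<bullet> (x - y)"
      by (simp add: inner_diff_right)
    also have "\<dots> \<le> support_function B u + norm u * dist x y"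
      using inner_le_support[of B y u] y convex_bodyD[OF B] norm_cauchy_schwarz[of u "x - y"]
      by (simp add: dist_norm add_mono)
    also have "\<dots> \<le> support_function B u + norm u * d"
      using d[OF x(1)] y by (simp add: mult_left_mono)
    finally show ?thesis
      using x by simp
  qed
  show ?thesis
    using aux[OF K L infdist_le_hausdorff_dist(1)[OF K L]]
      aux[OF L K infdist_le_hausdorff_dist(2)[OF K L]] by simp
qed

text \<open>If \<open>y\<close> is the point of a body nearest to \<open>x\<close>, that body
  attains its support in direction \<open>x - y\<close> at \<open>y\<close>. The two support
  functions therefore differ in that direction by at least the distance from \<open>x\<close> to
  \<open>y\<close>.\<close>

lemma hausdorff_dist_le_support:
  assumes K: "K \<in> convex_bodies" and L: "L \<in> convex_bodies" and e: "0 \<le> e"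
    and close: "\<And>u. norm u = 1 \<Longrightarrow> \<bar>support_function K u - support_function L u\<bar> \<le> e"
  shows "hausdorff_dist K L \<le> e"
proof -
  have aux: "infdist x B \<le> e"
    if A: "A \<in> convex_bodies" and B: "B \<in> convex_bodies" and x: "x \<in> A"
      and close: "\<And>u. norm u = 1 \<Longrightarrow> support_function A u \<le> support_function B u + e"
    for A B :: "'a set" and x
  proof -
    define y where "y = closest_point B x"
    have y: "y \<in> B"
      unfolding y_def by (rule closest_point_in_set) (use B convex_bodyD in auto)
    have opt: "(x - y) \<bullet> (z - y) \<le> 0" if "z \<in> B" for z
      unfolding y_def by (rule closest_point_dot[OF convex_bodyD(3,5)[OF B] that])
    have "dist x y \<le> e"
    proof (cases "x = y")
      case False
      define u where "u = (1 / norm (x - y)) *\<^sub>R (x - y)"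
      have u: "norm u = 1" "u \<bullet> (x - y) = norm (x - y)"
        using False by (simp_all add: u_def dot_square_norm power2_eq_square)
      have "u \<bullet> z \<le> u \<bullet> y" if "z \<in> B" for z
        using opt[OF that] by (simp add: u_def inner_diff_right divide_right_mono)
      then have "support_function B u = u \<bullet> y"
        by (rule support_eqI[OF y])
      moreover have "u \<bullet> x \<le> support_function A u"
        using inner_le_support x convex_bodyD[OF A] by blast
      ultimately show ?thesis
        using close[OF u(1)] u(2) by (simp add: inner_diff_right dist_norm)
    qed (use e in simp)
    then show ?thesis
      using infdist_le[OF y, of x] by linarith
  qed
  show ?thesis
  proof (rule hausdorff_dist_leI)
    show "infdist x L \<le> e" if "x \<in> K" for x
      using aux[OF K L that] close by (smt (verit))
    show "infdist x K \<le> e" if "x \<in> L" for x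
      using aux[OF L K that] close by (smt (verit))
  qed (use K L convex_bodyD in auto)
qed

section \<open>Functional equations and inequalities for real functions\<close>

text \<open>Cauchy's equation on the half-line. Additivity settles rational arguments; the limit at
  \<open>0\<close> from the right suffices for the others, since approximating \<open>x\<close> from
  below leaves a nonnegative remainder.\<close>

lemma additive_nonneg_imp_linear:
  fixes f :: "real \<Rightarrow> real"
  assumes add: "\<And>x y. 0 \<le> x \<Longrightarrow> 0 \<le> y \<Longrightarrow> f (x + y) = f x + f y"
    and cont: "(f \<longlongrightarrow> 0) (at_right 0)" and x: "0 \<le> x"
  shows "f x = x * f 1"
proof -
  have f0: "f 0 = 0"
    using add[of 0 0] by simp
  have mult: "f (real n * y) = real n * f y" if "0 \<le> y" for n y
    by (induction n) (use that in \<open>simp_all add: f0 add distrib_right\<close>)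
  have cont0: "(f \<longlongrightarrow> 0) (at 0 within {0..})"
    using cont by (simp add: at_within_Ici_at_right)
  \<comment> \<open>\<open>m n / Suc n\<close> is the largest multiple of \<open>1 / Suc n\<close>
    not exceeding \<open>x\<close>.\<close>
  define m where "m n = nat \<lfloor>real (Suc n) * x\<rfloor>" for n
  define r where "r n = x - real (m n) / real (Suc n)" for n
  have m: "real (m n) = of_int \<lfloor>real (Suc n) * x\<rfloor>" for n
    using x by (simp add: m_def)
  have r: "0 \<le> r n" "r n \<le> 1 / real (Suc n)" for n
  proof -
    define N where "N = real (Suc n)"
    have "0 < N" "real (m n) \<le> N * x" "N * x \<le> real (m n) + 1"
      unfolding m N_def by linarith+
    then have "real (m n) / N \<le> x" "x \<le> (real (m n) + 1) / N"
      by (simp_all add: pos_divide_le_eq pos_le_divide_eq mult.commute)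
    then show "0 \<le> r n" "r n \<le> 1 / real (Suc n)"
      unfolding r_def N_def[symmetric] by (simp_all add: add_divide_distrib)
  qed
  have r0: "r \<longlonglongrightarrow> 0"
    by (rule tendsto_sandwich[OF _ _ tendsto_const LIMSEQ_Suc[OF lim_1_over_n]])
       (use r in \<open>auto simp del: of_nat_Suc\<close>)
  have fr: "(\<lambda>n. f (r n)) \<longlonglongrightarrow> 0"
    using continuous_within_tendsto_compose'[OF _ _ r0, of "{0..}" f] cont0 r(1) f0
    by (simp add: continuous_within)
  have fm: "f (real (m n) / real (Suc n)) = (x - r n) * f 1" for n
  proof -
    have "real (Suc n) * f (1 / real (Suc n)) = f 1"
      by (subst mult[symmetric]) (simp_all del: of_nat_Suc)
    then have "f (1 / real (Suc n)) = f 1 / real (Suc n)"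
      by (simp add: field_simps del: of_nat_Suc)
    then show ?thesis
      using mult[of "1 / real (Suc n)" "m n"] by (simp add: r_def del: of_nat_Suc)
  qed
  have "f x = (x - r n) * f 1 + f (r n)" for n
    using add[of "real (m n) / real (Suc n)" "r n"] r(1)[of n] fm[of n] by (simp add: r_def)
  moreover have "(\<lambda>n. (x - r n) * f 1 + f (r n)) \<longlonglongrightarrow> (x - 0) * f 1 + 0"
    by (intro tendsto_intros r0 fr)
  ultimately have "(\<lambda>n. f x) \<longlonglongrightarrow> x * f 1"
    by simp
  then show ?thesis
    using LIMSEQ_unique[OF tendsto_const] by blast
qed

text \<open>
  The prescribed width is linear on each of six cones. There \<open>p\<close> and its reflection are both
  subadditive with additive sum, hence additive, so \<open>p\<close> is determined by its values on the six rays.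
\<close>

lemma sublinear_triangle_decomposition:
  fixes p :: "real \<Rightarrow> real \<Rightarrow> real"
  assumes sub: "\<And>x y x' y'. p (x + x') (y + y') \<le> p x y + p x' y'"
    and hom: "\<And>c x y. 0 \<le> c \<Longrightarrow> p (c * x) (c * y) = c * p x y"
    and width: "\<And>x y. p x y + p (- x) (- y) = (\<bar>x\<bar> + \<bar>y\<bar> + \<bar>x - y\<bar>) / 2"
  obtains a s t where "0 \<le> a" "a \<le> 1"
    "\<And>x y. p x y = a * max 0 (max x y) + (1 - a) * max 0 (max (- x) (- y)) + s * x + t * y"
proof -
  have add: "p (x + x') (y + y') = p x y + p x' y'"
    if "\<bar>x\<bar> + \<bar>y\<bar> + \<bar>x - y\<bar> + (\<bar>x'\<bar> + \<bar>y'\<bar> + \<bar>x' - y'\<bar>)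
      = \<bar>x + x'\<bar> + \<bar>y + y'\<bar> + \<bar>(x + x') - (y + y')\<bar>" for x y x' y'
    using sub[of x x' y y'] sub[of "-x" "-x'" "-y" "-y'"] width[of x y] width[of x' y']
      width[of "x + x'" "y + y'"] that by (simp add: algebra_simps)
  \<comment> \<open>Solved from \<open>p 1 0 = a + s\<close>, \<open>p 0 1 = a + t\<close> and
    \<open>p 1 1 = a + s + t\<close>.\<close>
  define a where "a = p 1 0 + p 0 1 - p 1 1"
  define s where "s = p 1 1 - p 0 1"
  define t where "t = p 1 1 - p 1 0"
  have w: "p (- 1) 0 = 1 - p 1 0" "p 0 (- 1) = 1 - p 0 1" "p (- 1) (- 1) = 1 - p 1 1"
    using width[of 1 0] width[of 0 1] width[of 1 1] by simp_all
  \<comment> \<open>Subadditivity for \<open>(1,0) + (0,1) = (1,1)\<close> bounds \<open>a\<close>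
    from below; for the opposite vectors it bounds \<open>a\<close> from above.\<close>
  have "0 \<le> a"
    using sub[of 1 0 0 1] by (simp add: a_def)
  moreover have "a \<le> 1"
    using sub[of "-1" 0 0 "-1"] w by (simp add: a_def)
  moreover have "p x y = a * max 0 (max x y) + (1 - a) * max 0 (max (- x) (- y)) + s * x + t * y"
    for x y
  proof -
    consider "0 \<le> y" "y \<le> x" | "0 \<le> x" "x \<le> y" | "x \<le> 0" "0 \<le> y"
      | "x \<le> y" "y \<le> 0" | "y \<le> x" "x \<le> 0" | "0 \<le> x" "y \<le> 0"
      by linarith
    then show ?thesis
    proof cases
      case 1
      then have "p x y = p ((x - y) * 1) ((x - y) * 0) + p (y * 1) (y * 1)"
        by (subst add[symmetric]) auto
      also have "\<dots> = (x - y) * p 1 0 + y * p 1 1"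
        using 1 by (subst (1 2) hom) auto
      finally show ?thesis
        using 1 by (simp add: a_def s_def t_def algebra_simps)
    next
      case 2
      then have "p x y = p ((y - x) * 0) ((y - x) * 1) + p (x * 1) (x * 1)"
        by (subst add[symmetric]) auto
      also have "\<dots> = (y - x) * p 0 1 + x * p 1 1"
        using 2 by (subst (1 2) hom) auto
      finally show ?thesis
        using 2 by (simp add: a_def s_def t_def algebra_simps)
    next
      case 3
      then have "p x y = p ((- x) * (- 1)) ((- x) * 0) + p (y * 0) (y * 1)"
        by (subst add[symmetric]) auto
      also have "\<dots> = (- x) * p (- 1) 0 + y * p 0 1"
        using 3 by (subst (1 2) hom) auto
      finally show ?thesis
        using 3 by (simp add: a_def s_def t_def w algebra_simps)
    next
      case 4
      then have "p x y = p ((y - x) * (- 1)) ((y - x) * 0) + p ((- y) * (- 1)) ((- y) * (- 1))"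
        by (subst add[symmetric]) auto
      also have "\<dots> = (y - x) * p (- 1) 0 + (- y) * p (- 1) (- 1)"
        using 4 by (subst (1 2) hom) auto
      finally show ?thesis
        using 4 by (simp add: a_def s_def t_def w algebra_simps)
    next
      case 5
      then have "p x y = p ((x - y) * 0) ((x - y) * (- 1)) + p ((- x) * (- 1)) ((- x) * (- 1))"
        by (subst add[symmetric]) auto
      also have "\<dots> = (x - y) * p 0 (- 1) + (- x) * p (- 1) (- 1)"
        using 5 by (subst (1 2) hom) auto
      finally show ?thesis
        using 5 by (simp add: a_def s_def t_def w algebra_simps)
    next
      case 6
      then have "p x y = p (x * 1) (x * 0) + p ((- y) * 0) ((- y) * (- 1))"
        by (subst add[symmetric]) auto
      also have "\<dots> = x * p 1 0 + (- y) * p 0 (- 1)"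
        using 6 by (subst (1 2) hom) auto
      finally show ?thesis
        using 6 by (simp add: a_def s_def t_def w algebra_simps)
    qed
  qed
  ultimately show thesis
    by (rule that)
qed

text \<open>\<open>tri a\<close> is the support function of \<open>a T + (1 - a) (- T)\<close>,
  where \<open>T\<close> has vertices \<open>0\<close>, \<open>B\<close>, \<open>C\<close>, written
  in the coordinates \<open>x = w \<bullet> B\<close>, \<open>y = w \<bullet> C\<close> of a
  direction \<open>w\<close>. The equation is the cevian identity up to linear terms. Its odd part
  loses the term with \<open>n\<close>, and of each triangle only the factor \<open>2 a - 1\<close>
  survives.\<close>

lemma cevian_coefficients_eq:
  fixes a b c s l m n :: real
  defines "tri \<equiv> \<lambda>a x y. a * max 0 (max x y) + (1 - a) * max 0 (max (- x) (- y))"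
  assumes s: "0 < s" "s < 1"
    and eq: "\<And>x y. tri a x ((1 - s) * x + s * y) + tri b ((1 - s) * x + s * y) y
      = tri c x y + n * \<bar>(1 - s) * x + s * y\<bar> + l * x + m * y"
  shows "a = c"
proof -
  have odd: "tri a x y - tri a (- x) (- y) =
      (2 * a - 1) * (max 0 (max x y) - max 0 (max (- x) (- y)))" for a x y
    unfolding tri_def by (simp add: algebra_simps)
  define od :: "real \<Rightarrow> real \<Rightarrow> real"
    where "od x y = max 0 (max x y) - max 0 (max (- x) (- y))" for x y
  have eq': "(2 * a - 1) * od x ((1 - s) * x + s * y) + (2 * b - 1) * od ((1 - s) * x + s * y) y
      = (2 * c - 1) * od x y + 2 * (l * x + m * y)" for x y
  proof -
    define d where "d = (1 - s) * x + s * y"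
    have d: "(1 - s) * (- x) + s * (- y) = - d"
      by (simp add: d_def algebra_simps)
    have "tri a (- x) (- d) + tri b (- d) (- y) = tri c (- x) (- y) + n * \<bar>d\<bar> - (l * x + m * y)"
      using eq[of "- x" "- y"] unfolding d by simp
    then show ?thesis
      using eq[of x y] odd[of a x d] odd[of b d y] odd[of c x y]
      unfolding d_def[symmetric] od_def[symmetric] by simp
  qed
  define A B C where "A = 2 * a - 1" and "B = 2 * b - 1" and "C = 2 * c - 1"
  have 1: "A + B * (1 - s) = C + 2 * l"
    using eq'[of 1 0] s unfolding A_def B_def C_def od_def by (simp add: max_def)
  have 2: "A * s + B = C + 2 * m"
    using eq'[of 0 1] s unfolding A_def B_def C_def od_def by (simp add: max_def)
  have 3: "A + B = C + 2 * (l + m)"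
    using eq'[of 1 1] s unfolding A_def B_def C_def od_def by (simp add: max_def)
  \<comment> \<open>\<open>(s, s - 1)\<close> is the direction orthogonal to the cevian: there
    \<open>(1 - s) x + s y\<close> vanishes. The values at \<open>(1,0)\<close>,
    \<open>(0,1)\<close>, \<open>(1,1)\<close> only give \<open>C = A s + B (1 - s)\<close>; this
    fourth one forces \<open>A = B\<close>.\<close>
  have zero: "(1 - s) * s + s * (s - 1) = 0"
    by (simp add: algebra_simps)
  have 4: "A * s + B * (s - 1) = C * (2 * s - 1) + 2 * (l * s + m * (s - 1))"
    using eq'[of s "s - 1"] s unfolding A_def B_def C_def od_def zero by (simp add: max_def)
  have "C = A * s + B * (1 - s)"
    using 1 2 3 by (simp add: algebra_simps)
  moreover have "s * (1 - s) * A = s * (1 - s) * B"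
  proof -
    have l: "2 * l = A + B * (1 - s) - C" and m: "2 * m = A * s + B - C"
      using 1 2 by simp_all
    have "A * s + B * (s - 1) = C * (2 * s - 1) + (2 * l) * s + (2 * m) * (s - 1)"
      using 4 by (simp add: algebra_simps)
    then show ?thesis
      unfolding l m by (simp add: algebra_simps)
  qed
  then have "A = B"
    using s by simp
  ultimately have "A = C"
    by (simp add: algebra_simps)
  then show ?thesis
    by (simp add: A_def C_def)
qed

subsection \<open>The Euclidean plane\<close>

definition rot :: "real \<Rightarrow> real^2^2" where
  "rot \<theta> = vector [vector [cos \<theta>, - sin \<theta>], vector [sin \<theta>, cos \<theta>]]"

lemma rot_mult_component [simp]:
  "(rot \<theta> *v x) $ 1 = cos \<theta> * x $ 1 - sin \<theta> * x $ 2"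
  "(rot \<theta> *v x) $ 2 = sin \<theta> * x $ 1 + cos \<theta> * x $ 2"
  by (simp_all add: rot_def matrix_vector_mult_def sum_2)

lemma circle_point_component [simp]:
  "circle_point \<theta> $ 1 = cos \<theta>" "circle_point \<theta> $ 2 = sin \<theta>"
  by (simp_all add: circle_point_def)

lemma inner_real2: "x \<bullet> y = x $ 1 * y $ 1 + x $ 2 * y $ 2" for x y :: "real^2"
  by (simp add: inner_vec_def sum_2)

lemma real2_eq_iff: "x = y \<longleftrightarrow> x $ 1 = y $ 1 \<and> x $ 2 = y $ 2" for x y :: "'a^2"
  by (simp add: vec_eq_iff forall_2)

lemma transpose_rot: "transpose (rot \<theta>) = rot (- \<theta>)"
  by (simp add: real2_eq_iff transpose_def rot_def)

lemma rot_rot: "rot \<theta> *v (rot \<psi> *v x) = rot (\<theta> + \<psi>) *v x"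
  by (simp add: real2_eq_iff cos_add sin_add algebra_simps)

lemma rot_zero: "rot 0 *v x = x"
  by (simp add: real2_eq_iff)

lemma rot_pi: "rot pi *v x = - x"
  by (simp add: real2_eq_iff)

lemma rot_circle_point: "rot \<theta> *v circle_point \<psi> = circle_point (\<theta> + \<psi>)"
  by (simp add: real2_eq_iff cos_add sin_add)

lemma rotation_matrix_rot: "rotation_matrix (rot \<theta>)"
proof -
  have "transpose (rot \<theta>) ** rot \<theta> = mat 1"
    unfolding transpose_rot
    by (simp add: matrix_eq matrix_vector_mul_assoc[symmetric] rot_rot rot_zero)
  moreover have "det (rot \<theta>) = 1"
    by (simp add: det_2 rot_def flip: power2_eq_square)
  ultimately show ?thesis
    by (simp add: rotation_matrix_def orthogonal_matrix)
qed

lemma norm_circle_point [simp]: "norm (circle_point \<theta>) = 1"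
  by (simp add: norm_eq_1 inner_real2 flip: power2_eq_square)

lemma polar_real2:
  obtains r \<theta> where "0 \<le> r" "x = r *\<^sub>R circle_point \<theta>"
proof -
  define z where "z = Complex (x $ 1) (x $ 2)"
  have "x = cmod z *\<^sub>R circle_point (Arg z)"
    using rcis_cmod_Arg[of z] by (simp add: real2_eq_iff z_def complex_eq_iff)
  then show thesis
    using that by (metis norm_ge_zero)
qed

definition cross2 :: "real^2 \<Rightarrow> real^2 \<Rightarrow> real" where
  "cross2 x y = x $ 1 * y $ 2 - x $ 2 * y $ 1"

lemma cross2_rot: "cross2 (rot \<theta> *v x) (rot \<theta> *v y) = cross2 x y"
proof -
  have "cross2 (rot \<theta> *v x) (rot \<theta> *v y) = (cos \<theta> * cos \<theta> + sin \<theta> * sin \<theta>) * cross2 x y"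
    unfolding cross2_def rot_mult_component by algebra
  then show ?thesis
    by (simp flip: power2_eq_square)
qed

lemma dual_basis_real2:
  assumes "cross2 b c \<noteq> 0"
  obtains u v where "u \<bullet> b = 1" "u \<bullet> c = 0" "v \<bullet> b = 0" "v \<bullet> c = 1"
    "\<And>w. w = (w \<bullet> b) *\<^sub>R u + (w \<bullet> c) *\<^sub>R v"
proof
  \<comment> \<open>Cramer's rule: quarter turns of \<open>c\<close> and \<open>b\<close>, divided
    by the determinant.\<close>
  define u v :: "real^2" where "u = (1 / cross2 b c) *\<^sub>R vector [c $ 2, - (c $ 1)]"
    and "v = (1 / cross2 b c) *\<^sub>R vector [- (b $ 2), b $ 1]"
  have e: "b $ 1 * c $ 2 = cross2 b c + b $ 2 * c $ 1"
    by (simp add: cross2_def)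
  show "u \<bullet> b = 1" "u \<bullet> c = 0" "v \<bullet> b = 0" "v \<bullet> c = 1"
    using assms e by (simp_all add: u_def v_def inner_real2 field_simps)
  show "w = (w \<bullet> b) *\<^sub>R u + (w \<bullet> c) *\<^sub>R v" for w
  proof -
    have "cross2 b c *\<^sub>R ((w \<bullet> b) *\<^sub>R u + (w \<bullet> c) *\<^sub>R v) = cross2 b c *\<^sub>R w"
      using assms by (simp add: u_def v_def real2_eq_iff inner_real2 scaleR_add_right)
        (simp add: cross2_def algebra_simps)
    then show ?thesis
      using assms by simp
  qed
qed

subsection \<open>The Steiner point\<close>

lemma integral_shift_real:
  fixes f :: "real \<Rightarrow> 'a::euclidean_space"
  assumes "continuous_on UNIV f"
  shows "integral {a..b} (\<lambda>x. f (x + c)) = integral {a + c..b + c} f"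
proof -
  have "(f has_integral integral {a + c..b + c} f) (cbox (a + c) (b + c))"
    using continuous_on_subset[OF assms]
    by (simp add: integrable_integral integrable_continuous_real)
  from has_integral_affinity[OF this, of 1 c]
  have "((\<lambda>x. f (x + c)) has_integral integral {a + c..b + c} f) ((\<lambda>x. x + - c) ` {a + c..b + c})"
    by simp
  moreover have "(\<lambda>x. x + - c) ` {a + c..b + c} = {a..b}"
    by (simp add: image_affinity_atLeastAtMost_diff flip: add_uminus_conv_diff)
  ultimately show ?thesis
    by (metis integral_unique)
qed

text \<open>Whole periods are split off \<open>a\<close> until the window starts at some
  \<open>b\<close> in \<open>[0, p]\<close>; its part beyond \<open>p\<close> is then moved back by
  one period.\<close>

lemma integral_periodic:
  fixes f :: "real \<Rightarrow> 'a::euclidean_space"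
  assumes cont: "continuous_on UNIV f" and per: "\<And>x. f (x + p) = f x" and p: "0 < p"
  shows "integral {a..a + p} f = integral {0..p} f"
proof -
  interpret periodic_fun_simple f p
    by standard (rule per)
  have int: "f integrable_on {u..v}" for u v
    using continuous_on_subset[OF cont] by (simp add: integrable_continuous_real)
  define k where "k = \<lfloor>a / p\<rfloor>"
  define b where "b = a - of_int k * p"
  have "of_int k \<le> a / p" "a / p \<le> of_int k + 1"
    unfolding k_def by linarith+
  then have b: "0 \<le> b" "b \<le> p"
    using p by (simp_all add: b_def pos_le_divide_eq pos_divide_le_eq algebra_simps)
  have "integral {a..a + p} f = integral {b + of_int k * p..b + p + of_int k * p} f"
    by (simp add: b_def algebra_simps)
  also have "\<dots> = integral {b..b + p} (\<lambda>x. f (x + of_int k * p))"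
    by (rule integral_shift_real[OF cont, symmetric])
  also have "\<dots> = integral {b..b + p} f"
    by (simp only: plus_of_int)
  also have "\<dots> = integral {b..p} f + integral {p..b + p} f"
    by (rule Henstock_Kurzweil_Integration.integral_combine[symmetric]) (use b p int in auto)
  also have "integral {p..b + p} f = integral {0..b} (\<lambda>x. f (x + p))"
    using integral_shift_real[OF cont, of 0 b p] by simp
  also have "\<dots> = integral {0..b} f"
    by (simp only: per)
  also have "integral {b..p} f + integral {0..b} f = integral {0..p} f"
    using Henstock_Kurzweil_Integration.integral_combine[OF b int] by (simp add: add.commute)
  finally show ?thesis .
qed

text \<open>Each left-endpoint rectangle of width \<open>d\<close> errs by at most
  \<open>L d^2\<close>. The bound sees \<open>f\<close> only through \<open>L\<close>, so it is
  uniform over all directions in which a support function is averaged.\<close>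

lemma riemann_sum_error:
  fixes f :: "real \<Rightarrow> real"
  assumes lip: "\<And>x y. \<bar>f x - f y\<bar> \<le> L * \<bar>x - y\<bar>" and d: "0 \<le> d" and L: "0 \<le> L"
  shows "\<bar>(\<Sum>k<n. d * f (real k * d)) - integral {0..real n * d} f\<bar> \<le> real n * L * d\<^sup>2"
proof (induction n)
  case (Suc n)
  have cont: "continuous_on S f" for S
    by (rule lipschitz_on_continuous_on[of L], rule lipschitz_onI)
       (use lip L in \<open>auto simp: dist_real_def\<close>)
  then have int: "f integrable_on {a..b}" for a b
    by (rule integrable_continuous_real)
  define c where "c = real n * d"
  have c: "real (Suc n) * d = c + d" "0 \<le> c"
    using d by (simp_all add: c_def algebra_simps)
  have "integral {0..c} f + integral {c..c + d} f = integral {0..c + d} f"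
    by (rule Henstock_Kurzweil_Integration.integral_combine) (use c d int in auto)
  moreover have "\<bar>integral {c..c + d} f - d * f c\<bar> \<le> L * d\<^sup>2"
  proof -
    have "((\<lambda>x. f x - f c) has_integral (integral {c..c + d} f - d * f c)) (cbox c (c + d))"
      using has_integral_diff[OF integrable_integral[OF int] has_integral_const_real[of "f c"],
          of c "c + d"] d by simp
    moreover have "norm (f x - f c) \<le> L * d" if "x \<in> cbox c (c + d)" for x
      using lip[of x c] mult_left_mono[OF _ L, of "\<bar>x - c\<bar>" d] that by auto
    ultimately have "norm (integral {c..c + d} f - d * f c) \<le> L * d * measure lborel (cbox c (c + d))"
      using d L by (intro has_integral_bound[where f = "\<lambda>x. f x - f c"]) auto
    then show ?thesis
      using d by (simp add: power2_eq_square)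
  qed
  ultimately show ?case
    using Suc unfolding c c_def[symmetric] by (simp add: algebra_simps c_def)
qed simp

text \<open>A chord is at most as long as its arc: its length is
  \<open>2 |sin ((a - b) / 2)|\<close>.\<close>

lemma norm_circle_point_diff: "norm (circle_point a - circle_point b) \<le> \<bar>a - b\<bar>"
proof -
  have "(norm (circle_point a - circle_point b))\<^sup>2
      = (cos a)\<^sup>2 + (sin a)\<^sup>2 + ((cos b)\<^sup>2 + (sin b)\<^sup>2) - 2 * (cos a * cos b + sin a * sin b)"
    by (simp only: power2_norm_eq_inner inner_real2) (simp add: power2_eq_square algebra_simps)
  also have "\<dots> = 2 - 2 * cos (a - b)"
    by (simp add: cos_diff)
  also have "\<dots> = (2 * sin ((a - b) / 2))\<^sup>2"
  proof -
    have "a - b = 2 * ((a - b) / 2)"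
      by simp
    then have "cos (a - b) = 1 - 2 * (sin ((a - b) / 2))\<^sup>2"
      by (metis cos_double_sin)
    then show ?thesis
      by (simp add: power2_eq_square)
  qed
  also have "\<dots> \<le> (a - b)\<^sup>2"
    unfolding abs_le_square_iff[symmetric]
    using abs_sin_x_le_abs_x[of "(a - b) / 2"] by (simp add: abs_mult)
  finally show ?thesis
    by (simp flip: abs_le_square_iff)
qed

lemma continuous_circle_point: "continuous_on S circle_point"
  by (rule lipschitz_on_continuous_on[of 1], rule lipschitz_onI)
     (use norm_circle_point_diff in \<open>auto simp: dist_norm\<close>)

text \<open>\<open>B\<close> is the radius of a ball around the origin containing \<open>K\<close>;
  subadditivity turns the bound into a Lipschitz constant.\<close>

lemma support_bounded:
  assumes "K \<in> convex_bodies"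
  obtains B where "0 \<le> B" "\<And>u. \<bar>support_function K u\<bar> \<le> B * norm u"
    "\<And>u v. \<bar>support_function K u - support_function K v\<bar> \<le> B * norm (u - v)"
proof -
  obtain B where B: "0 < B" "\<And>x. x \<in> K \<Longrightarrow> norm x \<le> B"
    using convex_bodyD(4)[OF assms] bounded_pos by blast
  have abs: "\<bar>support_function K u\<bar> \<le> B * norm u" for u
  proof -
    obtain x where "x \<in> K" "support_function K u = u \<bullet> x"
      using support_attained[OF assms] .
    moreover from this have "norm u * norm x \<le> B * norm u"
      using mult_right_mono[OF B(2), of x "norm u"] by (simp add: mult.commute)
    ultimately show ?thesis
      using Cauchy_Schwarz_ineq2[of u x] by linarith
  qed
  have le: "support_function K u \<le> support_function K v + B * norm (u - v)" for u v
    using support_subadditive[OF assms, of v "u - v"] abs[of "u - v"] by simp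
  have "\<bar>support_function K u - support_function K v\<bar> \<le> B * norm (u - v)" for u v
    using le[of u v] le[of v u] by (simp add: norm_minus_commute)
  then show thesis
    using that[of B] B(1) abs by simp
qed

lemma continuous_support:
  assumes "K \<in> convex_bodies"
  shows "continuous_on S (support_function K)"
proof -
  obtain B where "0 \<le> B"
    "\<And>u v. \<bar>support_function K u - support_function K v\<bar> \<le> B * norm (u - v)"
    using support_bounded[OF assms] by metis
  then show ?thesis
    by (intro lipschitz_on_continuous_on[of B] lipschitz_onI) (auto simp: dist_norm)
qed

lemma continuous_support_circle:
  assumes "K \<in> convex_bodies"
  shows "continuous_on S (\<lambda>t. support_function K (circle_point t))"
  by (rule continuous_on_compose2[OF continuous_support[OF assms, of UNIV] continuous_circle_point]) simp

lemma pi_steiner_point: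
  "pi *\<^sub>R steiner_point K = integral {0..2 * pi} (\<lambda>t. support_function K (circle_point t) *\<^sub>R circle_point t)"
proof -
  have "area (cball 0 1) = pi"
    by (simp add: content_cball unit_ball_vol_2)
  then show ?thesis
    by (simp add: steiner_point_def)
qed

lemma integrable_steiner:
  "K \<in> convex_bodies \<Longrightarrow>
    (\<lambda>t. support_function K (circle_point t) *\<^sub>R circle_point t) integrable_on {a..b}"
  by (intro integrable_continuous_real continuous_intros continuous_support_circle
      continuous_circle_point)

lemma has_integral_steiner:
  "K \<in> convex_bodies \<Longrightarrow> ((\<lambda>t. support_function K (circle_point t) *\<^sub>R circle_point t)
    has_integral pi *\<^sub>R steiner_point K) {0..2 * pi}"
  unfolding pi_steiner_point by (intro integrable_integral integrable_steiner)

lemma circle_point_periodic: "circle_point (t + 2 * pi) = circle_point t"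
  by (simp add: real2_eq_iff)

text \<open>The support function enters the Steiner integral linearly, so linear relations between
  support functions, with coefficients of either sign, pass to Steiner points.\<close>

lemma steiner_eqI:
  assumes "K \<in> convex_bodies" "L \<in> convex_bodies" "M \<in> convex_bodies"
    and "\<And>u. support_function K u = a * support_function L u + b * support_function M u"
  shows "steiner_point K = a *\<^sub>R steiner_point L + b *\<^sub>R steiner_point M"
proof -
  have "((\<lambda>t. support_function K (circle_point t) *\<^sub>R circle_point t) has_integral
      a *\<^sub>R (pi *\<^sub>R steiner_point L) + b *\<^sub>R (pi *\<^sub>R steiner_point M)) {0..2 * pi}"
    using has_integral_add[OF has_integral_cmul[OF has_integral_steiner[OF assms(2)], of a]
        has_integral_cmul[OF has_integral_steiner[OF assms(3)], of b]]
    by (simp add: assms(4) scaleR_add_left)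
  then have "pi *\<^sub>R steiner_point K = a *\<^sub>R (pi *\<^sub>R steiner_point L) + b *\<^sub>R (pi *\<^sub>R steiner_point M)"
    unfolding pi_steiner_point[of K] by (rule integral_unique)
  also have "\<dots> = pi *\<^sub>R (a *\<^sub>R steiner_point L + b *\<^sub>R steiner_point M)"
    by (simp add: algebra_simps)
  finally show ?thesis
    by simp
qed

text \<open>This is the normalisation of the Steiner point: the integral of
  \<open>(u \<bullet> x) u\<close> over the circle is \<open>pi x\<close>, and \<open>pi\<close> is
  the area of the disc. \<open>F\<close> is an explicit antiderivative.\<close>

lemma steiner_singleton: "steiner_point {x} = x"
proof -
  have anti: "((\<lambda>t. support_function {x} (circle_point t) *\<^sub>R circle_point t) has_integral
      (F (2 * pi) - F 0)) {0..2 * pi}"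
    if F: "F = (\<lambda>t. vector [x $ 1 * (t + sin t * cos t) / 2 + x $ 2 * (sin t)\<^sup>2 / 2,
      x $ 1 * (sin t)\<^sup>2 / 2 + x $ 2 * (t - sin t * cos t) / 2])" for F :: "real \<Rightarrow> real^2"
  proof (rule fundamental_theorem_of_calculus)
    fix t :: real assume "t \<in> {0..2 * pi}"
    have 1: "((\<lambda>t. F t $ 1) has_real_derivative
        (support_function {x} (circle_point t) *\<^sub>R circle_point t) $ 1) (at t within {0..2 * pi})"
    proof -
      have "x $ 1 * (1 + (cos t * cos t - sin t * sin t)) / 2 + x $ 2 * (2 * sin t * cos t) / 2
          = (cos t * x $ 1 + sin t * x $ 2) * cos t"
        using sin_cos_squared_add[of t] unfolding power2_eq_square by algebra
      then show ?thesis
        unfolding F vector_2 support_singleton inner_real2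
        by (auto intro!: derivative_eq_intros simp: algebra_simps)
    qed
    have 2: "((\<lambda>t. F t $ 2) has_real_derivative
        (support_function {x} (circle_point t) *\<^sub>R circle_point t) $ 2) (at t within {0..2 * pi})"
    proof -
      have "x $ 1 * (2 * sin t * cos t) / 2 + x $ 2 * (1 - (cos t * cos t - sin t * sin t)) / 2
          = (cos t * x $ 1 + sin t * x $ 2) * sin t"
        using sin_cos_squared_add[of t] unfolding power2_eq_square by algebra
      then show ?thesis
        unfolding F vector_2 support_singleton inner_real2
        by (auto intro!: derivative_eq_intros simp: algebra_simps)
    qed
    have "((\<lambda>t. F t $ i) has_vector_derivative
        (support_function {x} (circle_point t) *\<^sub>R circle_point t) $ i) (at t within {0..2 * pi})" for i
      using 1 2 exhaust_2[of i] by (auto simp: has_real_derivative_iff_has_vector_derivative)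
    then show "(F has_vector_derivative support_function {x} (circle_point t) *\<^sub>R circle_point t)
        (at t within {0..2 * pi})"
      by (simp add: mult.assoc has_vector_derivative_def has_derivative_componentwise_within[of F]
          Basis_vec_def inner_axis)
  qed simp
  have "pi *\<^sub>R steiner_point {x} = pi *\<^sub>R x"
    unfolding pi_steiner_point integral_unique[OF anti[OF refl]] by (simp add: real2_eq_iff)
  then show ?thesis
    by simp
qed

lemma steiner_rot:
  assumes "K \<in> convex_bodies"
  shows "steiner_point ((*v) (rot \<theta>) ` K) = rot \<theta> *v steiner_point K"
proof -
  let ?F = "\<lambda>t. support_function K (circle_point t) *\<^sub>R circle_point t"
  have cont: "continuous_on UNIV ?F"
    by (intro continuous_intros continuous_support_circle continuous_circle_point assms)
  have "pi *\<^sub>R steiner_point ((*v) (rot \<theta>) ` K)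
      = integral {0..2 * pi} (\<lambda>t. rot \<theta> *v ?F (t + - \<theta>))"
    unfolding pi_steiner_point support_matrix transpose_rot rot_circle_point
    by (simp add: matrix_vector_mult_scaleR rot_circle_point add.commute)
  also have "\<dots> = rot \<theta> *v integral {0..2 * pi} (\<lambda>t. ?F (t + - \<theta>))"
    using integral_linear[of "\<lambda>t. ?F (t + - \<theta>)" "{0..2 * pi}" "(*v) (rot \<theta>)"]
      continuous_on_compose2[OF cont, of "{0..2 * pi}" "\<lambda>t. t + - \<theta>"]
    by (simp add: o_def integrable_continuous_real continuous_intros matrix_vector_mul_bounded_linear)
  also have "integral {0..2 * pi} (\<lambda>t. ?F (t + - \<theta>)) = integral {- \<theta>..- \<theta> + 2 * pi} ?F"
    using integral_shift_real[OF cont, of 0 "2 * pi" "- \<theta>"] by (simp add: add.commute)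
  also have "\<dots> = integral {0..2 * pi} ?F"
    by (rule integral_periodic[OF cont]) (simp_all add: circle_point_periodic)
  also have "rot \<theta> *v \<dots> = pi *\<^sub>R (rot \<theta> *v steiner_point K)"
    by (simp add: pi_steiner_point[symmetric] matrix_vector_mult_scaleR)
  finally show ?thesis
    by simp
qed

section \<open>Averages over rotations\<close>

lemma convex_body_sum:
  assumes "\<And>i. i \<in> A \<Longrightarrow> K i \<in> convex_bodies"
  shows "(\<Sum>i\<in>A. K i) \<in> convex_bodies"
  using assms
  by (induction A rule: infinite_finite_induct) (auto simp: set_zero)

lemma support_sum:
  assumes "\<And>i. i \<in> A \<Longrightarrow> K i \<in> convex_bodies"
  shows "support_function (\<Sum>i\<in>A. K i) u = (\<Sum>i\<in>A. support_function (K i) u)"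
  using assms
proof (induction A rule: infinite_finite_induct)
  case (insert i A)
  then show ?case
    by (simp add: support_plus convex_body_sum)
qed (simp_all add: support_singleton set_zero)

lemma norm_one_circle_point:
  assumes "norm u = 1"
  obtains \<theta> where "u = circle_point \<theta>"
proof -
  obtain r \<theta> where "0 \<le> r" "u = r *\<^sub>R circle_point \<theta>"
    by (rule polar_real2)
  then show thesis
    using assms that by simp
qed

text \<open>\<open>cos (t - \<phi>)\<close> is the inner product of the unit vectors at angles
  \<open>t\<close> and \<open>\<phi>\<close>. Weighting with it picks the Fourier coefficients of
  order one, and these form \<open>pi\<close> times the Steiner point.\<close>

lemma support_circle_average:
  assumes K: "K \<in> convex_bodies"
  shows "integral {0..2 * pi} (\<lambda>t. (1 + cos t) * support_function K (circle_point (\<phi> + t)))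
    = integral {0..2 * pi} (\<lambda>t. support_function K (circle_point t))
      + circle_point \<phi> \<bullet> (pi *\<^sub>R steiner_point K)"
proof -
  define h where "h t = support_function K (circle_point t)" for t
  define F where "F t = (1 + cos (t - \<phi>)) * h t" for t
  have h: "continuous_on S h" for S
    unfolding h_def by (rule continuous_support_circle[OF K])
  have cont: "continuous_on UNIV F"
    unfolding F_def by (intro continuous_intros h)
  have "integral {0..2 * pi} (\<lambda>t. (1 + cos t) * support_function K (circle_point (\<phi> + t)))
      = integral {0..2 * pi} (\<lambda>t. F (t + \<phi>))"
    by (simp add: F_def h_def add.commute)
  also have "\<dots> = integral {\<phi>..\<phi> + 2 * pi} F"
    using integral_shift_real[OF cont, of 0 "2 * pi" \<phi>] by (simp add: add.commute)
  also have "\<dots> = integral {0..2 * pi} F"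
  proof (rule integral_periodic[OF cont])
    show "F (t + 2 * pi) = F t" for t
      unfolding F_def h_def circle_point_periodic
      by (metis cos_periodic diff_add_eq add_diff_eq)
  qed simp
  also have "F = (\<lambda>t. h t + circle_point \<phi> \<bullet> (h t *\<^sub>R circle_point t))"
    by (simp add: F_def fun_eq_iff inner_real2 cos_diff algebra_simps)
  also have "integral {0..2 * pi} \<dots> = integral {0..2 * pi} h + circle_point \<phi> \<bullet> (pi *\<^sub>R steiner_point K)"
  proof (rule integral_unique, rule has_integral_add)
    show "(h has_integral integral {0..2 * pi} h) {0..2 * pi}"
      using h by (intro integrable_integral integrable_continuous_real)
    show "((\<lambda>t. circle_point \<phi> \<bullet> (h t *\<^sub>R circle_point t)) has_integral
        circle_point \<phi> \<bullet> (pi *\<^sub>R steiner_point K)) {0..2 * pi}"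
      using has_integral_linear[OF has_integral_steiner[OF K] bounded_linear_inner_right]
      by (simp add: o_def h_def)
  qed
  finally show ?thesis
    by (simp add: h_def[abs_def])
qed

lemma tendsto_rotation_mean:
  assumes K: "K \<in> convex_bodies"
  obtains e where "e \<longlonglongrightarrow> 0"
    "\<And>n \<phi>. \<bar>(\<Sum>k<Suc n. (2 * pi / real (Suc n)) * ((1 + cos (real k * (2 * pi / real (Suc n)))) *
        support_function K (circle_point (\<phi> + real k * (2 * pi / real (Suc n))))))
      - (integral {0..2 * pi} (\<lambda>t. support_function K (circle_point t))
        + circle_point \<phi> \<bullet> (pi *\<^sub>R steiner_point K))\<bar> \<le> e n"
proof -
  obtain B where B: "0 \<le> B" "\<And>u. \<bar>support_function K u\<bar> \<le> B * norm u"
    "\<And>u v. \<bar>support_function K u - support_function K v\<bar> \<le> B * norm (u - v)"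
    using support_bounded[OF K] by metis
  \<comment> \<open>The averaged function has Lipschitz constant \<open>3 B\<close>:
    \<open>2 B\<close> from \<open>1 + cos\<close> being at most 2, and \<open>B\<close> from the
    slope of \<open>cos\<close>. With step \<open>d = 2 pi / Suc n\<close> the Riemann sum errs by
    at most \<open>Suc n * (3 B) * d^2\<close>.\<close>
  define e where "e n = 12 * pi\<^sup>2 * B / real (Suc n)" for n
  have "e \<longlonglongrightarrow> 0"
    unfolding e_def by (intro LIMSEQ_Suc lim_const_over_n)
  moreover have "\<bar>(\<Sum>k<Suc n. (2 * pi / real (Suc n)) * ((1 + cos (real k * (2 * pi / real (Suc n)))) *
        support_function K (circle_point (\<phi> + real k * (2 * pi / real (Suc n))))))
      - (integral {0..2 * pi} (\<lambda>t. support_function K (circle_point t))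
        + circle_point \<phi> \<bullet> (pi *\<^sub>R steiner_point K))\<bar> \<le> e n" for n \<phi>
  proof -
    define f where "f t = (1 + cos t) * support_function K (circle_point (\<phi> + t))" for t
    have "\<bar>f s - f t\<bar> \<le> (3 * B) * \<bar>s - t\<bar>" for s t
    proof -
      let ?h = "\<lambda>t. support_function K (circle_point (\<phi> + t))"
      have cos: "\<bar>cos s - cos t\<bar> \<le> \<bar>s - t\<bar>"
        using component_le_norm_cart[of "circle_point s - circle_point t" 1]
          norm_circle_point_diff[of s t] by simp
      have h: "\<bar>?h s - ?h t\<bar> \<le> B * \<bar>s - t\<bar>" "\<bar>?h t\<bar> \<le> B"
        using B(3)[of "circle_point (\<phi> + s)" "circle_point (\<phi> + t)"]
          mult_left_mono[OF norm_circle_point_diff[of "\<phi> + s" "\<phi> + t"] B(1)]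
          B(2)[of "circle_point (\<phi> + t)"] by auto
      have cos2: "\<bar>1 + cos s\<bar> \<le> 2"
        using cos_ge_minus_one[of s] cos_le_one[of s] by linarith
      have "\<bar>f s - f t\<bar> = \<bar>(1 + cos s) * (?h s - ?h t) + (cos s - cos t) * ?h t\<bar>"
        by (simp add: f_def algebra_simps)
      also have "\<dots> \<le> \<bar>1 + cos s\<bar> * \<bar>?h s - ?h t\<bar> + \<bar>cos s - cos t\<bar> * \<bar>?h t\<bar>"
        by (metis abs_mult abs_triangle_ineq)
      also have "\<dots> \<le> 2 * (B * \<bar>s - t\<bar>) + \<bar>s - t\<bar> * B"
        using cos h B(1) cos2
        by (intro add_mono mult_mono) auto
      finally show ?thesis
        by simp
    qed
    from riemann_sum_error[OF this, of "2 * pi / real (Suc n)" "Suc n"]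
    have "\<bar>(\<Sum>k<Suc n. (2 * pi / real (Suc n)) * f (real k * (2 * pi / real (Suc n))))
        - integral {0..2 * pi} f\<bar> \<le> real (Suc n) * (3 * B) * (2 * pi / real (Suc n))\<^sup>2"
      using B(1) by (simp del: of_nat_Suc sum.lessThan_Suc)
    also have "\<dots> = e n"
      by (simp add: e_def power2_eq_square del: of_nat_Suc)
    finally show ?thesis
      unfolding support_circle_average[OF K, symmetric] f_def .
  qed
  ultimately show thesis
    by (rule that)
qed

subsection \<open>Minkowski endomorphisms\<close>

locale minkowski_endo =
  fixes \<Phi> :: "(real^2) set \<Rightarrow> (real^2) set"
  assumes endo: "minkowski_endomorphism \<Phi>"
begin

lemma body [intro, simp]: "K \<in> convex_bodies \<Longrightarrow> \<Phi> K \<in> convex_bodies"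
  using endo by (simp add: minkowski_endomorphism_def)

lemma translation: "K \<in> convex_bodies \<Longrightarrow> \<Phi> ((\<lambda>x. x + t) ` K) = \<Phi> K"
  using endo by (simp add: minkowski_endomorphism_def)

lemma plus: "K \<in> convex_bodies \<Longrightarrow> L \<in> convex_bodies \<Longrightarrow> \<Phi> (K + L) = \<Phi> K + \<Phi> L"
  using endo by (simp add: minkowski_endomorphism_def)

lemma rotation: "K \<in> convex_bodies \<Longrightarrow> \<Phi> ((*v) (rot \<theta>) ` K) = (*v) (rot \<theta>) ` \<Phi> K"
  using endo rotation_matrix_rot by (simp add: minkowski_endomorphism_def)

lemma reflection:
  assumes "K \<in> convex_bodies"
  shows "\<Phi> (uminus ` K) = uminus ` \<Phi> K"
  using rotation[OF assms, of pi] by (simp add: rot_pi cong: image_cong)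

text \<open>Continuity of \<Phi>, restated so that Hausdorff distances need not be handled again: a
  bound on the support functions that is uniform over unit vectors is a bound on the Hausdorff
  distance.\<close>

lemma tendsto_support:
  assumes K: "K \<in> convex_bodies" and A: "\<And>x. A x \<in> convex_bodies"
    and close: "\<forall>\<^sub>F x in F. \<forall>v. norm v = 1 \<longrightarrow>
      \<bar>support_function (A x) v - support_function K v\<bar> \<le> e x"
    and e: "(e \<longlongrightarrow> 0) F"
  shows "((\<lambda>x. support_function (\<Phi> (A x)) u) \<longlongrightarrow> support_function (\<Phi> K) u) F"
proof (rule tendstoI)
  fix r :: real assume r: "0 < r"
  define \<epsilon> where "\<epsilon> = r / (norm u + 1)"
  have \<epsilon>: "0 < \<epsilon>"
    unfolding \<epsilon>_def using r by (intro divide_pos_pos) (auto intro: add_nonneg_pos)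
  obtain \<delta> where \<delta>: "0 < \<delta>" "\<And>L. L \<in> convex_bodies \<Longrightarrow> hausdorff_dist L K < \<delta> \<Longrightarrow>
      hausdorff_dist (\<Phi> L) (\<Phi> K) < \<epsilon>"
    using endo K \<epsilon> unfolding minkowski_endomorphism_def hausdorff_continuous_def by meson
  have "\<forall>\<^sub>F x in F. dist (e x) 0 < \<delta>"
    using e \<delta>(1) by (rule tendstoD)
  with close show "\<forall>\<^sub>F x in F. dist (support_function (\<Phi> (A x)) u) (support_function (\<Phi> K) u) < r"
  proof eventually_elim
    case (elim x)
    \<comment> \<open>Some unit vector has to exist for the uniform bound to force
      \<open>0 \<le> e x\<close>.\<close>
    have "norm (axis 1 1 :: real^2) = 1"
      by simp
    then have "0 \<le> e x"
      using elim(1) abs_ge_zero order_trans by blast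
    then have "hausdorff_dist (A x) K \<le> e x"
      using elim(1) by (intro hausdorff_dist_le_support A K) auto
    then have "hausdorff_dist (\<Phi> (A x)) (\<Phi> K) < \<epsilon>"
      using elim(2) by (intro \<delta>(2) A) auto
    then have "norm u * hausdorff_dist (\<Phi> (A x)) (\<Phi> K) \<le> norm u * \<epsilon>"
      by (intro mult_left_mono) auto
    moreover have "norm u * \<epsilon> < r"
    proof -
      have "(norm u + 1) * \<epsilon> = r"
        using add_nonneg_pos[OF norm_ge_zero[of u] zero_less_one] by (simp add: \<epsilon>_def)
      then show ?thesis
        using \<epsilon> by (simp add: algebra_simps)
    qed
    ultimately show ?case
      using support_le_hausdorff_dist[OF body[OF A] body[OF K], of x u]
      by (simp add: dist_real_def)
  qed
qed

text \<open>\<open>{0}\<close> is idempotent under Minkowski addition, so the support function of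
  its image satisfies \<open>h = h + h\<close>.\<close>

lemma support_image_singleton: "support_function (\<Phi> {x}) u = 0"
proof -
  have "{0} + {0} = ({0} :: (real^2) set)"
    by (simp add: set_plus_def)
  then have "support_function (\<Phi> {0}) u = 0"
    using plus[of "{0}" "{0}"] support_plus[of "\<Phi> {0}" "\<Phi> {0}" u] by simp
  then show ?thesis
    using translation[of "{0}" x] by simp
qed

text \<open>Homogeneity is not among the axioms. For convex \<open>K\<close> the dilates satisfy
  \<open>(s + t) K = s K + t K\<close>, so additivity gives Cauchy's equation in the factor, and
  continuity of \<Phi> at a point gives the limit at \<open>0\<close>.\<close>

lemma support_image_scaleR:
  assumes K: "K \<in> convex_bodies" and r: "0 \<le> r"
  shows "support_function (\<Phi> ((*\<^sub>R) r ` K)) u = r * support_function (\<Phi> K) u"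
proof -
  define f where "f s = support_function (\<Phi> ((*\<^sub>R) s ` K)) u" for s
  have add: "f (s + t) = f s + f t" if "0 \<le> s" "0 \<le> t" for s t
  proof -
    have "(*\<^sub>R) (s + t) ` K = (*\<^sub>R) s ` K + (*\<^sub>R) t ` K"
      using that K
      by (intro convex_body_eqI)
        (auto simp: support_plus support_scaleR support_homogeneous distrib_right)
    then show ?thesis
      using K by (simp add: f_def plus support_plus)
  qed
  have "(f \<longlongrightarrow> 0) (at_right 0)"
  proof -
    obtain B where B: "\<And>u. \<bar>support_function K u\<bar> \<le> B * norm u"
      using support_bounded[OF K] by metis
    have "\<bar>support_function ((*\<^sub>R) s ` K) v - support_function {0} v\<bar> \<le> s * B"
      if "0 < s" "norm v = 1" for s v
      using B[of v] that
      by (simp add: support_singleton support_scaleR support_homogeneous[OF K] abs_mult)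
    then have *: "\<forall>\<^sub>F s in at_right 0. \<forall>v. norm v = 1 \<longrightarrow>
        \<bar>support_function ((*\<^sub>R) s ` K) v - support_function {0} v\<bar> \<le> s * B"
      by (intro eventually_at_rightI[of 0 1]) auto
    have "((\<lambda>s. s * B) \<longlongrightarrow> 0 * B) (at_right 0)"
      by (intro tendsto_intros)
    then show ?thesis
      using tendsto_support[OF _ _ *, of u] K unfolding f_def
      by (simp add: support_image_singleton)
  qed
  with add have "f r = r * f 1"
    using r by (rule additive_nonneg_imp_linear)
  then show ?thesis
    by (simp add: f_def)
qed

lemma support_image_sum:
  assumes "\<And>i. i \<in> A \<Longrightarrow> K i \<in> convex_bodies"
  shows "support_function (\<Phi> (\<Sum>i\<in>A. K i)) u = (\<Sum>i\<in>A. support_function (\<Phi> (K i)) u)"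
  using assms
proof (induction A rule: infinite_finite_induct)
  case (insert i A)
  then show ?case
    by (simp add: plus support_plus convex_body_sum)
qed (simp_all add: support_image_singleton set_zero)

text \<open>
  Averaging the rotated copies of a body with density \<open>1 + cos\<close> keeps only the Fourier
  coefficients of order 0 and \<open>\<plusminus>1\<close> of its support function. The mean of \<open>K\<close> is therefore a disc
  centred at a multiple of the Steiner point, and the same average taken after \<open>\<Phi>\<close> is the
  image of a centred disc.
\<close>

lemma rotation_mean:
  assumes K: "K \<in> convex_bodies" and h: "\<And>u. support_function K u \<ge> 0"
  shows "\<exists>B\<in>convex_bodies. uminus ` B = B \<and>
    (\<forall>\<phi>. support_function (\<Phi> B) (circle_point \<phi>)
      = integral {0..2 * pi} (\<lambda>t. support_function (\<Phi> K) (circle_point t))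
        + circle_point \<phi> \<bullet> (pi *\<^sub>R steiner_point (\<Phi> K)))"
proof -
  define m where "m = integral {0..2 * pi} (\<lambda>t. support_function K (circle_point t))"
  have m: "0 \<le> m"
    unfolding m_def using h
    by (intro Henstock_Kurzweil_Integration.integral_nonneg integrable_continuous_real
        continuous_support_circle K) auto
  \<comment> \<open>Rotating by \<open>- t\<close> shifts the support function by \<open>t\<close>
    along the circle, so that of \<open>A n\<close> is a Riemann sum for the integral in
    \<open>support_circle_average\<close>.\<close>
  define A where "A n = (\<Sum>k<Suc n. (*\<^sub>R) ((2 * pi / real (Suc n)) *
    (1 + cos (real k * (2 * pi / real (Suc n))))) ` (*v) (rot (- (real k * (2 * pi / real (Suc n))))) ` K)"
    for n
  have A: "A n \<in> convex_bodies" for n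
    unfolding A_def using K by (intro convex_body_sum) auto
  \<comment> \<open>Minkowski combinations need nonnegative weights, hence the density
    \<open>1 + cos\<close> in place of \<open>cos\<close>.\<close>
  have c: "0 \<le> (2 * pi / real (Suc n)) * (1 + cos t)" for n t
  proof -
    have "0 \<le> 1 + cos t"
      using cos_ge_minus_one[of t] by linarith
    then show ?thesis
      by simp
  qed
  have rot: "(2 * pi / real (Suc n) * (1 + cos t)) * support_function ((*v) (rot (- t)) ` L) (circle_point \<phi>)
      = (2 * pi / real (Suc n)) * ((1 + cos t) * support_function L (circle_point (\<phi> + t)))"
    for n t \<phi> and L :: "(real^2) set"
    by (simp only: support_matrix transpose_rot rot_circle_point minus_minus mult.assoc add.commute)
  have supA: "support_function (A n) (circle_point \<phi>) = (\<Sum>k<Suc n. (2 * pi / real (Suc n)) *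
      ((1 + cos (real k * (2 * pi / real (Suc n)))) *
        support_function K (circle_point (\<phi> + real k * (2 * pi / real (Suc n))))))" for n \<phi>
    unfolding A_def using K
    by (subst support_sum) (auto simp only: support_scaleR support_homogeneous[OF convex_body_matrix c]
        rot convex_body_scaleR convex_body_matrix)
  have supPA: "support_function (\<Phi> (A n)) (circle_point \<phi>) = (\<Sum>k<Suc n. (2 * pi / real (Suc n)) *
      ((1 + cos (real k * (2 * pi / real (Suc n)))) *
        support_function (\<Phi> K) (circle_point (\<phi> + real k * (2 * pi / real (Suc n))))))" for n \<phi>
    unfolding A_def using K
    by (subst support_image_sum) (auto simp only: support_image_scaleR[OF convex_body_matrix c] rotation
        rot convex_body_scaleR convex_body_matrix)
  define B where "B = (\<lambda>x. x + pi *\<^sub>R steiner_point K) ` cball (0 :: real^2) m"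
  have supB: "support_function B (circle_point \<phi>) = m + circle_point \<phi> \<bullet> (pi *\<^sub>R steiner_point K)" for \<phi>
    unfolding B_def using m by (simp add: support_translation support_cball_zero)
  have B: "B \<in> convex_bodies"
    unfolding B_def using m by auto
  obtain e where e: "e \<longlonglongrightarrow> 0"
    "\<And>n \<phi>. \<bar>support_function (A n) (circle_point \<phi>) - support_function B (circle_point \<phi>)\<bar> \<le> e n"
    unfolding supA supB m_def by (rule tendsto_rotation_mean[OF K], blast)
  obtain e' where e': "e' \<longlonglongrightarrow> 0"
    "\<And>n \<phi>. \<bar>support_function (\<Phi> (A n)) (circle_point \<phi>) -
      (integral {0..2 * pi} (\<lambda>t. support_function (\<Phi> K) (circle_point t))
        + circle_point \<phi> \<bullet> (pi *\<^sub>R steiner_point (\<Phi> K)))\<bar> \<le> e' n"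
    unfolding supPA by (rule tendsto_rotation_mean[OF body[OF K]], blast)
  have 1: "(\<lambda>n. support_function (\<Phi> (A n)) u) \<longlonglongrightarrow> support_function (\<Phi> B) u" for u
  proof (rule tendsto_support[OF B A _ e(1)], intro always_eventually allI impI)
    show "\<bar>support_function (A n) v - support_function B v\<bar> \<le> e n" if "norm v = 1" for n v
      by (rule norm_one_circle_point[OF that]) (simp only: e(2))
  qed
  have 2: "(\<lambda>n. support_function (\<Phi> (A n)) (circle_point \<phi>)) \<longlonglongrightarrow>
      integral {0..2 * pi} (\<lambda>t. support_function (\<Phi> K) (circle_point t))
        + circle_point \<phi> \<bullet> (pi *\<^sub>R steiner_point (\<Phi> K))" for \<phi>
    by (rule LIM_zero_cancel, rule Lim_null_comparison[OF _ e'(1)])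
       (intro always_eventually allI, unfold real_norm_def, rule e'(2))
  \<comment> \<open>\<Phi> does not see the translation in \<open>B\<close>, so the centred disc has
    the same image and serves as the symmetric witness.\<close>
  have "\<Phi> B = \<Phi> (cball 0 m)"
    unfolding B_def using m by (simp add: translation)
  moreover have "uminus ` cball 0 m = cball (0 :: real^2) m"
  proof -
    have "x \<in> uminus ` cball 0 m" if "x \<in> cball 0 m" for x :: "real^2"
      using image_eqI[of x uminus "- x"] that by simp
    then show ?thesis
      by auto
  qed
  ultimately show ?thesis
    using LIMSEQ_unique[OF 1 2] m by (intro bexI[of _ "cball 0 m"]) auto
qed

text \<open>The averaged image is \<Phi> of a body invariant under the half turn, so its support
  function is even. Its odd part is the linear functional given by \<open>pi\<close> times the
  Steiner point, which must therefore vanish.\<close>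

lemma steiner_image:
  assumes K: "K \<in> convex_bodies"
  shows "steiner_point (\<Phi> K) = 0"
proof -
  obtain x where x: "x \<in> K"
    using convex_bodyD[OF K] by blast
  \<comment> \<open>With the origin in \<open>L\<close> the support function is nonnegative, as
    \<open>rotation_mean\<close> requires, and \<Phi> ignores the shift.\<close>
  define L where "L = (\<lambda>y. y + (- x)) ` K"
  have L: "L \<in> convex_bodies"
    unfolding L_def by (rule convex_body_translation[OF K])
  have L0: "0 \<in> L"
    unfolding L_def using x by force
  have "\<Phi> L = \<Phi> K"
    unfolding L_def by (rule translation[OF K])
  moreover have "support_function L u \<ge> 0" for u
    using inner_le_support[OF convex_bodyD(4)[OF L] L0, of u] by simp
  ultimately obtain B where B: "B \<in> convex_bodies" "uminus ` B = B"
    "\<And>\<phi>. support_function (\<Phi> B) (circle_point \<phi>)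
      = integral {0..2 * pi} (\<lambda>t. support_function (\<Phi> K) (circle_point t))
        + circle_point \<phi> \<bullet> (pi *\<^sub>R steiner_point (\<Phi> K))"
    using rotation_mean[OF L] by metis
  define z where "z = steiner_point (\<Phi> K)"
  obtain r \<theta> where r: "0 \<le> r" "z = r *\<^sub>R circle_point \<theta>"
    by (rule polar_real2)
  have "support_function (\<Phi> B) (- circle_point \<theta>) = support_function (\<Phi> B) (circle_point \<theta>)"
    using reflection[OF B(1)] support_uminus[of "\<Phi> B" "circle_point \<theta>"] B(2) by simp
  moreover have "- circle_point \<theta> = circle_point (\<theta> + pi)"
    by (simp add: real2_eq_iff)
  ultimately have "circle_point (\<theta> + pi) \<bullet> (pi *\<^sub>R z) = circle_point \<theta> \<bullet> (pi *\<^sub>R z)"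
    using B(3)[of \<theta>] B(3)[of "\<theta> + pi"] by (simp add: z_def)
  then have "(- circle_point \<theta>) \<bullet> z = circle_point \<theta> \<bullet> z"
    unfolding \<open>- circle_point \<theta> = circle_point (\<theta> + pi)\<close>[symmetric] by simp
  then have "circle_point \<theta> \<bullet> z = 0"
    by simp
  then have "r = 0"
    by (simp add: r dot_square_norm)
  then show ?thesis
    using r by (simp add: z_def)
qed

end

lemma inner_rot: "(rot \<theta> *v x) \<bullet> y = x \<bullet> (rot (- \<theta>) *v y)"
  by (simp add: inner_real2 algebra_simps)

subsection \<open>Images of segments\<close>

text \<open>Centred at the origin, so that the half turn fixes it and its support function is
  \<open>|u \<bullet> v|\<close>; its length is twice that of \<open>v\<close>.\<close>

definition seg :: "'a::euclidean_space \<Rightarrow> 'a set" where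
  "seg v = closed_segment (- v) v"

lemma convex_body_seg [intro, simp]: "seg v \<in> convex_bodies"
  by (simp add: seg_def)

lemma support_seg: "support_function (seg v) u = \<bar>u \<bullet> v\<bar>"
  by (simp add: seg_def support_segment)

lemma uminus_seg: "uminus ` seg v = seg v"
  by (intro convex_body_eqI) (auto simp: support_uminus support_seg)

lemma segment_eq_seg:
  fixes p q :: "'a::euclidean_space"
  shows "closed_segment p q = (\<lambda>x. x + (1 / 2) *\<^sub>R (p + q)) ` seg ((1 / 2) *\<^sub>R (q - p))"
  by (intro convex_body_eqI)
     (auto simp: support_translation support_seg support_segment inner_simps field_simps max_def abs_if)

lemma area_eq_0_iff:
  assumes "K \<in> convex_bodies"
  shows "area K = 0 \<longleftrightarrow> interior K = {}"
  using assms convex_bodyD[OF assms] lmeasurable_compact[of K]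
  by (simp add: negligible_convex_interior[symmetric] negligible_iff_measure)

text \<open>A convex body without interior points lies on a line, and symmetry puts this line
  through the origin.\<close>

lemma symmetric_flat_body_is_seg:
  fixes X :: "(real^2) set"
  assumes X: "X \<in> convex_bodies" and sym: "uminus ` X = X" and int: "interior X = {}"
  obtains w where "X = seg w"
proof -
  obtain a b where ab: "a \<noteq> 0" "X \<subseteq> {x. a \<bullet> x = b}"
    using empty_interior_subset_hyperplane[OF convex_bodyD(3)[OF X] int] by metis
  have b: "b = 0"
  proof -
    obtain x where "x \<in> X"
      using convex_bodyD[OF X] by blast
    then have "- x \<in> X"
      using sym by blast
    then have "a \<bullet> x = b" "a \<bullet> (- x) = b"
      using ab(2) \<open>x \<in> X\<close> by blast+
    then show ?thesis
      by simp
  qed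
  \<comment> \<open>A quarter turn of the normal \<open>a\<close>: it spans the line that contains
    \<open>X\<close>.\<close>
  define v :: "real^2" where "v = vector [- (a $ 2), a $ 1]"
  have v: "v \<bullet> v = a \<bullet> a" "v \<bullet> v > 0"
    using ab(1) by (simp_all add: v_def inner_real2 flip: inner_gt_zero_iff)
  have par: "(v \<bullet> v) *\<^sub>R x = (v \<bullet> x) *\<^sub>R v" if "x \<in> X" for x
  proof -
    have "a $ 1 * x $ 1 + a $ 2 * x $ 2 = 0"
      using ab(2) that b by (auto simp: inner_real2)
    then show ?thesis
      unfolding v(1) by (simp add: real2_eq_iff inner_real2 v_def) algebra
  qed
  \<comment> \<open>\<open>w\<close> is the end point of \<open>X\<close> in direction
    \<open>v\<close>.\<close>
  obtain w where w: "w \<in> X" "support_function X v = v \<bullet> w"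
    using support_attained[OF X] .
  have wge: "\<bar>v \<bullet> x\<bar> \<le> v \<bullet> w" if "x \<in> X" for x
    using inner_le_support[OF convex_bodyD(4)[OF X] that, of v]
      inner_le_support[OF convex_bodyD(4)[OF X], of "- x" v] that sym w by force
  have "support_function X u = \<bar>u \<bullet> w\<bar>" for u
  proof (rule antisym)
    have "u \<bullet> x \<le> \<bar>u \<bullet> w\<bar>" if "x \<in> X" for x
    proof -
      have "(v \<bullet> v) * (u \<bullet> x) = (v \<bullet> x) * (u \<bullet> v)"
        using par[OF that] by (metis inner_scaleR_right)
      also have "\<dots> \<le> \<bar>v \<bullet> w\<bar> * \<bar>u \<bullet> v\<bar>"
        using wge[OF that] mult_right_mono[of "\<bar>v \<bullet> x\<bar>" "\<bar>v \<bullet> w\<bar>" "\<bar>u \<bullet> v\<bar>"]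
          abs_ge_self[of "(v \<bullet> x) * (u \<bullet> v)"] by (simp add: abs_mult)
      also have "\<dots> = \<bar>u \<bullet> ((v \<bullet> w) *\<^sub>R v)\<bar>"
        by (simp add: abs_mult)
      also have "\<dots> = (v \<bullet> v) * \<bar>u \<bullet> w\<bar>"
        unfolding par[OF w(1), symmetric] using v(2) by (simp add: abs_mult)
      finally show ?thesis
        using v(2) by (simp only: mult_le_cancel_left_pos)
    qed
    then show "support_function X u \<le> \<bar>u \<bullet> w\<bar>"
      using convex_bodyD(1)[OF X] by (rule support_le[rotated])
    show "\<bar>u \<bullet> w\<bar> \<le> support_function X u"
      using inner_le_support[OF convex_bodyD(4)[OF X] w(1), of u]
        inner_le_support[OF convex_bodyD(4)[OF X], of "- w" u] w(1) sym by force
  qed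
  then have "X = seg w"
    using X by (intro convex_body_eqI) (auto simp: support_seg)
  then show thesis
    by (rule that)
qed

text \<open>A body of positive area that is a sum of segments: the square contains the unit disc
  because the Euclidean norm is at most the sum of the absolute coordinates.\<close>

lemma axis_square_area_pos: "0 < area (seg (axis 1 1) + seg (axis 2 1))"
proof -
  let ?K = "seg (axis 1 1) + seg (axis 2 1) :: (real^2) set"
  have "cball 0 1 \<subseteq> ?K"
  proof (rule convex_body_subset_of_support)
    show "support_function (cball 0 1) u \<le> support_function ?K u" for u :: "real^2"
    proof (rule support_le)
      show "u \<bullet> x \<le> support_function ?K u" if "x \<in> cball 0 1" for x
      proof -
        have "u \<bullet> x \<le> norm u * norm x"
          by (rule norm_cauchy_schwarz)
        also have "\<dots> \<le> norm u"
          using that mult_left_mono[of "norm x" 1 "norm u"] by simp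
        also have "\<dots> \<le> \<bar>u $ 1\<bar> + \<bar>u $ 2\<bar>"
          using norm_le_l1_cart[of u] by (simp add: sum_2)
        finally show ?thesis
          by (simp add: support_plus support_seg inner_axis)
      qed
    qed simp
  qed auto
  then have "ball 0 1 \<subseteq> interior ?K"
    by (intro interior_maximal) (auto intro: order_trans[OF ball_subset_cball])
  then have "interior ?K \<noteq> {}"
    by auto
  then show ?thesis
    using area_eq_0_iff[of ?K] measure_nonneg[of lebesgue ?K] by (simp add: less_le)
qed

context minkowski_endo
begin

text \<open>One segment decides: each \<open>seg v\<close> is a dilated rotation of
  \<open>seg e\<close>, and plane rotations commute, so \<open>r\<close> and \<open>\<phi>\<close>
  are the same for all \<open>v\<close>.\<close>

lemma segment_images:
  assumes vc: "volume_comparable \<Phi>"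
  obtains r \<phi> where "0 < r"
    "\<And>u v. support_function (\<Phi> (seg v)) u = r * \<bar>u \<bullet> (rot \<phi> *v v)\<bar>"
proof -
  obtain c C where vc: "0 < c" "0 < C"
    "\<And>K. K \<in> convex_bodies \<Longrightarrow> c * area K \<le> area (\<Phi> K)"
    "\<And>K. K \<in> convex_bodies \<Longrightarrow> area (\<Phi> K) \<le> C * area K"
    using vc unfolding volume_comparable_def by blast
  define e where "e = circle_point 0"
  have "area (seg e) = 0"
    unfolding area_eq_0_iff[OF convex_body_seg] by (simp add: seg_def interior_closed_segment_ge2)
  then have "area (\<Phi> (seg e)) = 0"
    using vc(4)[of "seg e"] measure_nonneg[of lebesgue "\<Phi> (seg e)"] by simp
  then have int: "interior (\<Phi> (seg e)) = {}"
    using area_eq_0_iff by simp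
  have "uminus ` \<Phi> (seg e) = \<Phi> (seg e)"
    using reflection[of "seg e"] by (simp add: uminus_seg)
  then obtain w where w: "\<Phi> (seg e) = seg w"
    using symmetric_flat_body_is_seg[OF _ _ int] by auto
  obtain r \<phi> where r: "0 \<le> r" "w = r *\<^sub>R circle_point \<phi>"
    by (rule polar_real2)
  have main: "support_function (\<Phi> (seg v)) u = r * \<bar>u \<bullet> (rot \<phi> *v v)\<bar>" for u v
  proof -
    obtain s \<theta> where s: "0 \<le> s" "v = s *\<^sub>R circle_point \<theta>"
      by (rule polar_real2)
    have "seg v = (*\<^sub>R) s ` (*v) (rot \<theta>) ` seg e"
      using s by (intro convex_body_eqI)
        (auto simp: support_seg support_scaleR support_matrix transpose_rot e_def inner_rot
          rot_circle_point matrix_vector_mult_scaleR)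
    then have "support_function (\<Phi> (seg v)) u = s * \<bar>(rot (- \<theta>) *v u) \<bullet> w\<bar>"
      using s by (simp add: support_image_scaleR rotation support_matrix transpose_rot w support_seg)
    also have "\<dots> = s * r * \<bar>u \<bullet> circle_point (\<theta> + \<phi>)\<bar>"
      using r by (simp add: inner_rot rot_circle_point matrix_vector_mult_scaleR abs_mult)
    also have "\<dots> = r * \<bar>u \<bullet> (rot \<phi> *v v)\<bar>"
      using s by (simp add: matrix_vector_mult_scaleR rot_circle_point abs_mult add.commute)
    finally show ?thesis .
  qed
  \<comment> \<open>Otherwise the square would collapse to a point, against the lower bound in
    (VC).\<close>
  have "r \<noteq> 0"
  proof
    assume "r = 0"
    let ?K = "seg (axis 1 1) + seg (axis 2 1) :: (real^2) set"
    have "\<Phi> ?K = {0}"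
      by (intro convex_body_eqI)
         (auto simp: plus support_plus main \<open>r = 0\<close> support_singleton)
    then have "area (\<Phi> ?K) = 0"
      by simp
    moreover have "0 < c * area ?K"
      using vc(1) axis_square_area_pos by simp
    ultimately show False
      using vc(3)[of ?K] by simp
  qed
  then show thesis
    using that[of r \<phi>] r(1) main by simp
qed

end

subsection \<open>Cutting convex polygons along a diagonal\<close>

lemma cross2_sum: "cross2 x (a *\<^sub>R y + b *\<^sub>R z) = a * cross2 x y + b * cross2 x z"
  by (simp add: cross2_def algebra_simps)

lemma cross2_eq_0D:
  assumes "cross2 d z = 0" "d \<noteq> 0"
  obtains t where "z = t *\<^sub>R d"
proof -
  have "d \<bullet> d \<noteq> 0"
    using assms(2) by simp
  moreover have "(d \<bullet> d) *\<^sub>R z = (d \<bullet> z) *\<^sub>R d"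
    using assms(1) unfolding real2_eq_iff cross2_def
    by (simp add: inner_real2) algebra
  ultimately have "z = ((d \<bullet> z) / (d \<bullet> d)) *\<^sub>R d"
    by (metis (no_types, lifting) divide_inverse_commute inverse_eq_divide left_inverse scaleR_one scaleR_scaleR)
  then show thesis
    by (rule that)
qed

lemma affine_combination_solve:
  fixes p q z :: "'a::real_vector"
  assumes "s * (1 - t) = 1" "z = (1 - t) *\<^sub>R p + t *\<^sub>R q"
  shows "p = (1 - s) *\<^sub>R q + s *\<^sub>R z"
proof -
  have "(1 - s) *\<^sub>R q + s *\<^sub>R z = (1 - s * (1 - t)) *\<^sub>R q + (s * (1 - t)) *\<^sub>R p"
    unfolding assms(2) by (simp add: algebra_simps)
  then show ?thesis
    by (simp add: assms(1))
qed

lemma convex_hull_subset_remove: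
  assumes "x \<notin> convex hull (V - {x})" "A \<subseteq> V - {x}"
  shows "x \<notin> convex hull A"
  using assms hull_mono by blast

text \<open>Of three collinear points one lies between the other two, hence in their convex
  hull.\<close>

lemma cross2_neq_0_of_convex_position:
  assumes cp: "\<And>x. x \<in> V \<Longrightarrow> x \<notin> convex hull (V - {x})"
    and V: "p \<in> V" "q \<in> V" "x \<in> V" "p \<noteq> q" "x \<noteq> p" "x \<noteq> q"
  shows "cross2 (q - p) (x - p) \<noteq> 0"
proof
  assume "cross2 (q - p) (x - p) = 0"
  then obtain t where t: "x - p = t *\<^sub>R (q - p)"
    using V(4) by (elim cross2_eq_0D) auto
  have segs: "p \<notin> closed_segment q x" "q \<notin> closed_segment p x" "x \<notin> closed_segment p q"
    using cp[OF V(1)] cp[OF V(2)] cp[OF V(3)] V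
      convex_hull_subset_remove[of p V "{q, x}"] convex_hull_subset_remove[of q V "{p, x}"]
      convex_hull_subset_remove[of x V "{p, q}"]
    by (auto simp: segment_convex_hull)
  have x: "x = (1 - t) *\<^sub>R p + t *\<^sub>R q"
    using t by (simp add: algebra_simps)
  consider "t < 0" | "0 \<le> t" "t \<le> 1" | "1 < t"
    by linarith
  then show False
  proof cases
    case 1
    define s where "s = 1 / (1 - t)"
    have "s * (1 - t) = 1"
      using 1 by (simp add: s_def)
    then have "p = (1 - s) *\<^sub>R q + s *\<^sub>R x"
      using x by (rule affine_combination_solve)
    moreover have "0 \<le> s" "s \<le> 1"
      using 1 by (simp_all add: s_def)
    ultimately show False
      using segs(1) unfolding closed_segment_def by blast
  next
    case 2
    then show False
      using segs(3) x unfolding closed_segment_def by blast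
  next
    case 3
    define s where "s = 1 / t"
    have "t * s = 1"
      using 3 by (simp add: s_def)
    then have "q = (1 - s) *\<^sub>R p + s *\<^sub>R x"
      unfolding x by (simp add: scaleR_add_right mult.commute algebra_simps)
    moreover have "0 \<le> s" "s \<le> 1"
      using 3 by (simp_all add: s_def)
    ultimately show False
      using segs(2) unfolding closed_segment_def by blast
  qed
qed

text \<open>The segment from \<open>x\<close> to \<open>y\<close> meets the line through
  \<open>p\<close> and \<open>q\<close> in a point \<open>z\<close>, which convex position forces
  into the segment \<open>[p, q]\<close>. So the smaller of the two values
  \<open>u \<bullet> x\<close>, \<open>u \<bullet> y\<close> is at most
  \<open>u \<bullet> z\<close>, which is bounded by the values at \<open>p\<close> and
  \<open>q\<close>.\<close>

lemma separated_inner_le: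
  assumes cp: "\<And>x. x \<in> V \<Longrightarrow> x \<notin> convex hull (V - {x})"
    and V: "p \<in> V" "q \<in> V" "p \<noteq> q" "x \<in> V" "y \<in> V"
    and xy: "0 < cross2 (q - p) (x - p)" "cross2 (q - p) (y - p) < 0"
    and le: "u \<bullet> y \<le> u \<bullet> x"
  shows "u \<bullet> y \<le> max (u \<bullet> p) (u \<bullet> q)"
proof -
  \<comment> \<open>The barycentric weight at which the signed distance to the line through
    \<open>p\<close> and \<open>q\<close> vanishes.\<close>
  define s where "s = cross2 (q - p) (x - p) / (cross2 (q - p) (x - p) - cross2 (q - p) (y - p))"
  have s: "0 \<le> s" "s \<le> 1"
    and s0: "(1 - s) * cross2 (q - p) (x - p) + s * cross2 (q - p) (y - p) = 0"
    using xy by (simp_all add: s_def field_simps)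
  define z where "z = (1 - s) *\<^sub>R x + s *\<^sub>R y"
  have zp: "z - p = (1 - s) *\<^sub>R (x - p) + s *\<^sub>R (y - p)"
    by (simp add: z_def algebra_simps)
  have "cross2 (q - p) (z - p) = 0"
    unfolding zp cross2_sum s0 ..
  then obtain t where t: "z - p = t *\<^sub>R (q - p)"
    using V(3) by (elim cross2_eq_0D) auto
  have z: "z = (1 - t) *\<^sub>R p + t *\<^sub>R q"
    using t by (simp add: algebra_simps)
  have ne: "x \<noteq> p" "x \<noteq> q" "y \<noteq> p" "y \<noteq> q"
    using xy by (auto simp: cross2_def)
  have hull: "z \<in> convex hull {x, y}"
    unfolding z_def segment_convex_hull[symmetric] closed_segment_def using s by blast
  \<comment> \<open>Otherwise \<open>p\<close> lies between \<open>q\<close> and \<open>z\<close>,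
    hence in the hull of \<open>{q, x, y}\<close>, against convex position.\<close>
  have "0 \<le> t"
  proof (rule ccontr)
    assume "\<not> 0 \<le> t"
    define a where "a = 1 / (1 - t)"
    have "a * (1 - t) = 1"
      using \<open>\<not> 0 \<le> t\<close> by (simp add: a_def)
    then have "p = (1 - a) *\<^sub>R q + a *\<^sub>R z"
      using z by (rule affine_combination_solve)
    moreover have "0 \<le> a" "a \<le> 1"
      using \<open>\<not> 0 \<le> t\<close> by (simp_all add: a_def)
    moreover have "q \<in> convex hull {q, x, y}" "z \<in> convex hull {q, x, y}"
      using hull hull_mono[of "{x, y}" "{q, x, y}"] by (auto simp: hull_inc)
    ultimately have "p \<in> convex hull {q, x, y}"
      using convexD_alt[OF convex_convex_hull, of q "{q, x, y}" z a] by simp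
    then show False
      using convex_hull_subset_remove[OF cp[OF V(1)], of "{q, x, y}"] V ne by auto
  qed
  moreover have "t \<le> 1"
  proof (rule ccontr)
    assume "\<not> t \<le> 1"
    define a where "a = 1 / t"
    have "t * a = 1"
      using \<open>\<not> t \<le> 1\<close> by (simp add: a_def)
    then have "q = (1 - a) *\<^sub>R p + a *\<^sub>R z"
      unfolding z by (simp add: scaleR_add_right mult.commute algebra_simps)
    moreover have "0 \<le> a" "a \<le> 1"
      using \<open>\<not> t \<le> 1\<close> by (simp_all add: a_def)
    moreover have "p \<in> convex hull {p, x, y}" "z \<in> convex hull {p, x, y}"
      using hull hull_mono[of "{x, y}" "{p, x, y}"] by (auto simp: hull_inc)
    ultimately have "q \<in> convex hull {p, x, y}"
      using convexD_alt[OF convex_convex_hull, of p "{p, x, y}" z a] by simp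
    then show False
      using convex_hull_subset_remove[OF cp[OF V(2)], of "{p, x, y}"] V ne by auto
  qed
  ultimately have "u \<bullet> z \<le> max (u \<bullet> p) (u \<bullet> q)"
    unfolding z inner_add_right inner_scaleR_right
    by (intro convex_bound_le) auto
  moreover have "u \<bullet> y \<le> u \<bullet> z"
    unfolding z_def inner_add_right inner_scaleR_right
    using mult_left_mono[OF le, of "1 - s"] s by (simp add: algebra_simps)
  ultimately show ?thesis
    by simp
qed

text \<open>Any \<open>p\<close> will do. Among the three cyclic signs of \<open>f a b\<close>,
  \<open>f b c\<close>, \<open>f c a\<close> two agree; the point they share is a \<open>q\<close>
  for which the line through \<open>p\<close> and \<open>q\<close> has the other two points on
  opposite sides.\<close>

lemma exists_diagonal:
  assumes cp: "\<And>x. x \<in> V \<Longrightarrow> x \<notin> convex hull (V - {x})"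
    and fin: "finite V" and card: "4 \<le> card V"
  obtains p q x y where "p \<in> V" "q \<in> V" "p \<noteq> q" "x \<in> V" "y \<in> V"
    "0 < cross2 (q - p) (x - p)" "cross2 (q - p) (y - p) < 0"
proof -
  note goal = that
  obtain p where p: "p \<in> V"
    using card by (metis card.empty ex_in_conv not_numeral_le_zero)
  then have "3 \<le> card (V - {p})"
    using fin card by simp
  then obtain S where S: "S \<subseteq> V - {p}" "card S = 3"
    using obtain_subset_with_card_n by metis
  then obtain a b c where "S = {a, b, c}" "a \<noteq> b" "b \<noteq> c" "a \<noteq> c"
    by (auto simp: card_3_iff)
  with S p have pabc: "p \<in> V" "a \<in> V" "b \<in> V" "c \<in> V" "distinct [p, a, b, c]"
    by auto
  define f where "f x y = cross2 (x - p) (y - p)" for x y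
  have ne: "f a b \<noteq> 0" "f b c \<noteq> 0" "f c a \<noteq> 0"
    unfolding f_def using pabc(5)
      cross2_neq_0_of_convex_position[OF cp pabc(1,2,3)]
      cross2_neq_0_of_convex_position[OF cp pabc(1,3,4)]
      cross2_neq_0_of_convex_position[OF cp pabc(1,4,2)] by auto
  have anti: "f x y = - f y x" for x y
    by (simp add: f_def cross2_def)
  have found: thesis if "q \<in> {a, b, c}" "x \<in> V" "y \<in> V" "f q x > 0" "f q y < 0" for q x y
    by (rule goal[of p q x y]) (use that pabc in \<open>auto simp: f_def\<close>)
  consider "f a b > 0" "f c a > 0" | "f a b < 0" "f c a < 0" | "f a b > 0" "f b c > 0"
    | "f a b < 0" "f b c < 0" | "f b c > 0" "f c a > 0" | "f b c < 0" "f c a < 0"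
    using ne by linarith
  then show thesis
    using found[of a b c] found[of a c b] found[of b c a] found[of b a c] found[of c a b]
      found[of c b a] pabc anti[of a c] anti[of b a] anti[of c b] by cases auto
qed

text \<open>The support function of \<open>V\<close> is the maximum of those of its two halves, so
  their minimum must be that of the diagonal. It is at least that, since both halves contain
  \<open>p\<close> and \<open>q\<close>; it is at most that by
  \<open>separated_inner_le\<close>.\<close>

lemma convex_position_split:
  fixes V :: "(real^2) set"
  assumes cp: "\<And>x. x \<in> V \<Longrightarrow> x \<notin> convex hull (V - {x})"
    and fin: "finite V" and card: "4 \<le> card V"
  obtains V1 V2 p q where "V1 \<subset> V" "V2 \<subset> V" "V1 \<noteq> {}" "V2 \<noteq> {}"
    "convex hull V1 + convex hull V2 = convex hull V + closed_segment p q"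
proof -
  obtain p q x y where pq: "p \<in> V" "q \<in> V" "p \<noteq> q" and xy: "x \<in> V" "y \<in> V"
    "0 < cross2 (q - p) (x - p)" "cross2 (q - p) (y - p) < 0"
    using exists_diagonal[OF cp fin card] by metis
  define g where "g x = cross2 (q - p) (x - p)" for x
  define V1 where "V1 = {x \<in> V. 0 \<le> g x}"
  define V2 where "V2 = {x \<in> V. g x \<le> 0}"
  have gpq: "g p = 0" "g q = 0"
    by (simp_all add: g_def cross2_def)
  have V: "V = V1 \<union> V2" "p \<in> V1" "q \<in> V1" "p \<in> V2" "q \<in> V2"
    using pq gpq by (auto simp: V1_def V2_def)
  have fin12: "finite V1" "finite V2"
    using fin by (simp_all add: V1_def V2_def)
  have "y \<notin> V1" "x \<notin> V2"
    using xy by (simp_all add: V1_def V2_def g_def)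
  then have strict: "V1 \<subset> V" "V2 \<subset> V"
    using xy V by blast+
  have att: "\<exists>x\<in>A. support_function A u = u \<bullet> x" if "finite A" "A \<noteq> {}" for A and u :: "real^2"
  proof -
    have "Max ((\<bullet>) u ` A) \<in> (\<bullet>) u ` A"
      using that by (intro Max_in) auto
    then obtain x where "x \<in> A" "Max ((\<bullet>) u ` A) = u \<bullet> x"
      by blast
    then show ?thesis
      using that by (intro bexI[of _ x]) (simp_all add: support_function_def cSup_eq_Max)
  qed
  have ne: "V1 \<noteq> {}" "V2 \<noteq> {}" "V \<noteq> {}"
    using V by auto
  have sup: "support_function V1 u + support_function V2 u
      = support_function V u + max (u \<bullet> p) (u \<bullet> q)" for u
  proof -
    have le: "u \<bullet> x \<le> support_function A u" if "finite A" "x \<in> A" for x A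
      using that inner_le_support[OF finite_imp_bounded] by blast
    have V12: "support_function V u = max (support_function V1 u) (support_function V2 u)"
    proof -
      have "support_function V u = Max ((\<bullet>) u ` V1 \<union> (\<bullet>) u ` V2)"
        unfolding support_function_def V(1) image_Un
        using fin12 V(2) by (intro cSup_eq_Max) auto
      also have "\<dots> = max (support_function V1 u) (support_function V2 u)"
        using fin12 ne by (simp add: Max_Un support_function_def cSup_eq_Max)
      finally show ?thesis .
    qed
    obtain x1 where x1: "x1 \<in> V1" "support_function V1 u = u \<bullet> x1"
      using att[OF fin12(1)] V by blast
    obtain x2 where x2: "x2 \<in> V2" "support_function V2 u = u \<bullet> x2"
      using att[OF fin12(2)] V by blast
    have ge: "max (u \<bullet> p) (u \<bullet> q) \<le> support_function V1 u" "max (u \<bullet> p) (u \<bullet> q) \<le> support_function V2 u"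
      using le fin12 V by auto
    have zero: "x = p \<or> x = q" if "g x = 0" "x \<in> V" for x
      using cross2_neq_0_of_convex_position[OF cp pq(1,2) that(2) pq(3)] that(1) by (auto simp: g_def)
    have "min (u \<bullet> x1) (u \<bullet> x2) \<le> max (u \<bullet> p) (u \<bullet> q)"
    proof (cases "g x1 = 0 \<or> g x2 = 0")
      case True
      moreover have "x1 \<in> V" "x2 \<in> V"
        using x1 x2 V by auto
      ultimately have "x1 = p \<or> x1 = q \<or> x2 = p \<or> x2 = q"
        using zero by blast
      then show ?thesis
        by (auto simp: min_le_iff_disj le_max_iff_disj)
    next
      case False
      then have g: "0 < g x1" "g x2 < 0" "x1 \<in> V" "x2 \<in> V"
        using x1 x2 by (auto simp: V1_def V2_def)
      show ?thesis
      proof (cases "u \<bullet> x2 \<le> u \<bullet> x1")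
        case True
        then show ?thesis
          using separated_inner_le[OF cp pq g(3,4) g(1,2)[unfolded g_def]] by simp
      next
        case False
        have "0 < cross2 (p - q) (x2 - q)" "cross2 (p - q) (x1 - q) < 0"
          using g(1,2) by (simp_all add: g_def cross2_def algebra_simps)
        then show ?thesis
          using separated_inner_le[OF cp pq(2,1) pq(3)[symmetric] g(4,3), of u] False
          by (auto simp: max.commute)
      qed
    qed
    then show ?thesis
      using ge unfolding V12 x1(2) x2(2) by auto
  qed
  have "convex hull V1 + convex hull V2 = convex hull V + closed_segment p q"
    using fin fin12 ne
    by (intro convex_body_eqI) (auto simp: support_plus support_convex_hull support_segment sup)
  then show thesis
    using that strict ne by blast
qed

text \<open>The hull of a finite \<open>e\<close>-net chosen inside \<open>K\<close> stays inside
  \<open>K\<close>.\<close>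

lemma convex_body_polygon_approx:
  assumes K: "K \<in> convex_bodies" and e: "0 < e"
  obtains V :: "(real^2) set" where "finite V" "V \<noteq> {}" "hausdorff_dist (convex hull V) K \<le> e"
proof -
  obtain V where V: "finite V" "V \<subseteq> K" "K \<subseteq> (\<Union>x\<in>V. ball x e)"
    using seq_compact_imp_totally_bounded[of K] convex_bodyD(2)[OF K] e
    by (auto simp: compact_eq_seq_compact_metric)
  have ne: "V \<noteq> {}"
    using V(3) convex_bodyD(1)[OF K] by auto
  have sub: "convex hull V \<subseteq> K"
    using V(2) convex_bodyD(3)[OF K] by (rule hull_minimal)
  have "hausdorff_dist (convex hull V) K \<le> e"
  proof (rule hausdorff_dist_leI)
    show "infdist x K \<le> e" if "x \<in> convex hull V" for x
      using sub that e by (simp add: subset_iff)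
    show "infdist y (convex hull V) \<le> e" if y: "y \<in> K" for y
    proof -
      obtain x where "x \<in> V" "dist x y < e"
        using V(3) y by auto
      then show ?thesis
        by (intro infdist_le2[of x]) (auto simp: hull_inc dist_commute)
    qed
  qed (use ne convex_bodyD(1)[OF K] in auto)
  then show thesis
    using that V(1) ne by blast
qed

lemma linear_eq_inner:
  fixes f :: "'a::euclidean_space \<Rightarrow> real"
  assumes "linear f"
  obtains t where "\<And>u. f u = u \<bullet> t"
proof
  show "f u = u \<bullet> adjoint f (1::real)" for u
    using adjoint_works[OF assms, of u 1] by (simp add: inner_commute)
qed

lemma convex_hull_translation_insert:
  "(\<lambda>x. x + t) ` (convex hull S) = convex hull ((\<lambda>x. x + t) ` S)" for t :: "'a::real_vector"
  using convex_hull_translation[of t S] by (simp add: add.commute[of _ t])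

lemma triangle_translate:
  fixes A B C :: "'a::real_vector"
  shows "convex hull {A, B, C} = (\<lambda>x. x + A) ` (convex hull {0, B - A, C - A})"
  by (simp add: convex_hull_translation_insert)

lemma matrix_triangle:
  fixes g :: "real^'n^'m"
  shows "(*v) g ` (convex hull {0, B, C}) = convex hull {0, g *v B, g *v C}"
  by (simp add: convex_hull_linear_image)

subsection \<open>Endomorphisms mapping segments to segments\<close>

locale segment_endo = minkowski_endo +
  fixes r \<phi> :: real
  assumes r_pos: "0 < r"
    and seg_image: "\<And>u v. support_function (\<Phi> (seg v)) u = r * \<bar>u \<bullet> (rot \<phi> *v v)\<bar>"
begin

definition N :: "real^2 \<Rightarrow> real^2" where
  "N u = r *\<^sub>R (rot (- \<phi>) *v u)"

lemma linear_N: "linear N"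
  unfolding N_def
  by (intro linearI) (simp_all add: matrix_vector_right_distrib scaleR_add_right matrix_vector_mult_scaleR)

lemma N_simps: "N (u + v) = N u + N v" "N (c *\<^sub>R u) = c *\<^sub>R N u" "N (- u) = - N u"
  using linear_N by (simp_all add: linear_add linear_cmul linear_neg)

lemma inner_N: "N u \<bullet> v = u \<bullet> (r *\<^sub>R (rot \<phi> *v v))"
  by (simp add: N_def inner_rot)

lemma N_rot: "rot \<theta> *v N u = N (rot \<theta> *v u)"
  by (simp add: N_def matrix_vector_mult_scaleR rot_rot add.commute)

lemma support_seg_image: "support_function (\<Phi> (seg v)) u = \<bar>N u \<bullet> v\<bar>"
  using r_pos by (simp add: seg_image inner_N abs_mult)

text \<open>
  Linear functionals are the support functions of points, so \<open>linear_defect a K\<close> says that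
  \<open>\<Phi> K\<close> is a translate of \<open>a M K + (1 - a) (- M K)\<close>, where \<open>M\<close> is \<open>r\<close> times the rotation by \<open>\<phi>\<close>.
  \<open>N\<close> is the adjoint of \<open>M\<close>.
\<close>

definition defect :: "real \<Rightarrow> (real^2) set \<Rightarrow> real^2 \<Rightarrow> real" where
  "defect a K u = support_function (\<Phi> K) u
    - a * support_function K (N u) - (1 - a) * support_function K (- N u)"

definition linear_defect :: "real \<Rightarrow> (real^2) set \<Rightarrow> bool" where
  "linear_defect a K \<longleftrightarrow> linear (defect a K)"

lemma defect_plus:
  assumes "K \<in> convex_bodies" "L \<in> convex_bodies"
  shows "defect a (K + L) u = defect a K u + defect a L u"
  using assms by (simp add: defect_def plus support_plus algebra_simps)

lemma defect_translation:
  assumes "K \<in> convex_bodies"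
  shows "defect a ((\<lambda>x. x + t) ` K) u = defect a K u + (1 - 2 * a) * (N u \<bullet> t)"
  using assms by (simp add: defect_def translation support_translation algebra_simps)

lemma linear_inner_N: "linear (\<lambda>u. c * (N u \<bullet> t))"
  by (intro linearI) (simp_all add: N_simps inner_add_left algebra_simps)

text \<open>\<Phi> ignores a translation of \<open>K\<close>, while the two compared terms change by
  a multiple of \<open>N u \<bullet> t\<close>, which is linear in \<open>u\<close>.\<close>

lemma linear_defect_translation:
  assumes "K \<in> convex_bodies"
  shows "linear_defect a ((\<lambda>x. x + t) ` K) \<longleftrightarrow> linear_defect a K"
proof -
  have eq: "defect a ((\<lambda>x. x + t) ` K) = (\<lambda>u. defect a K u + (1 - 2 * a) * (N u \<bullet> t))"
    by (simp add: fun_eq_iff defect_translation[OF assms])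
  have "linear (defect a K)" if "linear (\<lambda>u. defect a K u + (1 - 2 * a) * (N u \<bullet> t))"
    using linear_compose_sub[OF that linear_inner_N[of "1 - 2 * a" t]] by simp
  then show ?thesis
    unfolding linear_defect_def eq using linear_compose_add[OF _ linear_inner_N] by blast
qed

lemma linear_defect_rot:
  assumes "K \<in> convex_bodies" "linear_defect a K"
  shows "linear_defect a ((*v) (rot \<theta>) ` K)"
proof -
  have neg: "rot \<theta>' *v (- x) = - (rot \<theta>' *v x)" for \<theta>' x
    by (simp add: real2_eq_iff)
  have "defect a ((*v) (rot \<theta>) ` K) = defect a K \<circ> (*v) (rot (- \<theta>))"
    using assms(1)
    by (simp add: fun_eq_iff defect_def rotation support_matrix transpose_rot N_rot neg)
  then show ?thesis
    using assms(2) linear_compose[OF matrix_vector_mul_linear] unfolding linear_defect_def by metis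
qed

text \<open>Holds for every \<open>a\<close>: the support function of \<open>seg v\<close> is even,
  and the weights \<open>a\<close> and \<open>1 - a\<close> add up to one. Segments can thus be
  subtracted in cutting identities whatever the parameter.\<close>

lemma defect_seg: "defect a (seg v) u = 0"
  by (simp add: defect_def support_seg_image support_seg algebra_simps)

lemma linear_defect_segment: "linear_defect a (closed_segment p q)"
proof -
  have "linear_defect a (seg v)" for v
    by (simp add: linear_defect_def defect_seg[abs_def] linear_zero)
  then show ?thesis
    unfolding segment_eq_seg[of p q] by (simp add: linear_defect_translation)
qed

lemma triangle_width_image:
  defines "T \<equiv> \<lambda>B C. convex hull {0, B, C}"
  shows "support_function (\<Phi> (T B C)) u + support_function (\<Phi> (T B C)) (- u)
    = (\<bar>N u \<bullet> B\<bar> + \<bar>N u \<bullet> C\<bar> + \<bar>N u \<bullet> B - N u \<bullet> C\<bar>) / 2"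
proof -
  \<comment> \<open>The factor one half compensates that \<open>seg v\<close> is twice as long as
    \<open>v\<close>; these are the edges of the triangle, centred.\<close>
  let ?h = "\<lambda>v. seg ((1 / 2) *\<^sub>R v) :: (real^2) set"
  have T: "T B C \<in> convex_bodies"
    by (simp add: T_def)
  have "T B C + uminus ` T B C = ?h B + ?h C + ?h (B - C)"
    using T
    by (intro convex_body_eqI)
       (auto simp: support_plus support_uminus support_seg T_def support_triangle inner_simps
          max_def abs_if field_simps)
  then have "support_function (\<Phi> (T B C + uminus ` T B C)) u
      = support_function (\<Phi> (?h B + ?h C + ?h (B - C))) u"
    by simp
  then show ?thesis
    using T by (simp add: plus support_plus reflection support_uminus support_seg_image inner_diff_right abs_mult)
qed

text \<open>Directions \<open>w\<close> are given the coordinates \<open>x = N w \<bullet> B\<close>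
  and \<open>y = N w \<bullet> C\<close>, in which the support function of every such triangle
  becomes \<open>max 0 (max x y)\<close>.\<close>

lemma dual_basis_N:
  assumes "cross2 B C \<noteq> 0"
  obtains u v where "\<And>x y. N (x *\<^sub>R u + y *\<^sub>R v) \<bullet> B = x" "\<And>x y. N (x *\<^sub>R u + y *\<^sub>R v) \<bullet> C = y"
    "\<And>w. w = (N w \<bullet> B) *\<^sub>R u + (N w \<bullet> C) *\<^sub>R v"
proof -
  have "cross2 (r *\<^sub>R (rot \<phi> *v B)) (r *\<^sub>R (rot \<phi> *v C)) = r * r * cross2 B C"
    unfolding cross2_rot[of \<phi> B C, symmetric] by (simp add: cross2_def algebra_simps)
  then have "cross2 (r *\<^sub>R (rot \<phi> *v B)) (r *\<^sub>R (rot \<phi> *v C)) \<noteq> 0"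
    using assms r_pos by simp
  then obtain u v where uv: "u \<bullet> (r *\<^sub>R (rot \<phi> *v B)) = 1" "u \<bullet> (r *\<^sub>R (rot \<phi> *v C)) = 0"
    "v \<bullet> (r *\<^sub>R (rot \<phi> *v B)) = 0" "v \<bullet> (r *\<^sub>R (rot \<phi> *v C)) = 1"
    "\<And>w. w = (w \<bullet> (r *\<^sub>R (rot \<phi> *v B))) *\<^sub>R u + (w \<bullet> (r *\<^sub>R (rot \<phi> *v C))) *\<^sub>R v"
    by (rule dual_basis_real2) blast
  show thesis
  proof (rule that[of u v])
    show "N (x *\<^sub>R u + y *\<^sub>R v) \<bullet> B = x" "N (x *\<^sub>R u + y *\<^sub>R v) \<bullet> C = y" for x y
      unfolding inner_N inner_add_left inner_scaleR_left[of _ _ "r *\<^sub>R _"] uv by simp_all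
    show "w = (N w \<bullet> B) *\<^sub>R u + (N w \<bullet> C) *\<^sub>R v" for w
      unfolding inner_N by (rule uv(5))
  qed
qed

text \<open>In the dual coordinates the prescribed widths are those of
  \<open>sublinear_triangle_decomposition\<close>; the terms \<open>s x + t y\<close> found there
  form the linear defect.\<close>

lemma triangle_linear_defect:
  assumes "cross2 B C \<noteq> 0"
  obtains a where "0 \<le> a" "a \<le> 1" "linear_defect a (convex hull {0, B, C})"
proof -
  define T where "T = convex hull {0, B, C}"
  have T: "T \<in> convex_bodies"
    by (simp add: T_def)
  obtain u v where uv: "\<And>x y. N (x *\<^sub>R u + y *\<^sub>R v) \<bullet> B = x" "\<And>x y. N (x *\<^sub>R u + y *\<^sub>R v) \<bullet> C = y"
    "\<And>w. w = (N w \<bullet> B) *\<^sub>R u + (N w \<bullet> C) *\<^sub>R v"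
    using dual_basis_N[OF assms] by blast
  define p where "p x y = support_function (\<Phi> T) (x *\<^sub>R u + y *\<^sub>R v)" for x y
  obtain a s t where a: "0 \<le> a" "a \<le> 1" and p:
    "\<And>x y. p x y = a * max 0 (max x y) + (1 - a) * max 0 (max (- x) (- y)) + s * x + t * y"
  proof (rule sublinear_triangle_decomposition[of p])
    show "p (x + x') (y + y') \<le> p x y + p x' y'" for x y x' y'
      using support_subadditive[OF body[OF T], of "x *\<^sub>R u + y *\<^sub>R v" "x' *\<^sub>R u + y' *\<^sub>R v"]
      by (simp add: p_def algebra_simps)
    show "p (c * x) (c * y) = c * p x y" if "0 \<le> c" for c x y
      using support_homogeneous[OF body[OF T] that, of "x *\<^sub>R u + y *\<^sub>R v"]
      by (simp add: p_def scaleR_add_right)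
    show "p x y + p (- x) (- y) = (\<bar>x\<bar> + \<bar>y\<bar> + \<bar>x - y\<bar>) / 2" for x y
      using triangle_width_image[of B C "x *\<^sub>R u + y *\<^sub>R v"] unfolding uv
      by (simp add: p_def T_def)
  qed blast
  have "defect a T = (\<lambda>w. s * (N w \<bullet> B) + t * (N w \<bullet> C))"
  proof
    fix w
    show "defect a T w = s * (N w \<bullet> B) + t * (N w \<bullet> C)"
    using p[of "N w \<bullet> B" "N w \<bullet> C"] unfolding p_def uv(3)[symmetric]
    by (simp add: defect_def T_def support_triangle)
  qed
  then have "linear_defect a T"
    by (simp add: linear_defect_def linear_compose_add linear_inner_N)
  then show thesis
    using that a unfolding T_def by blast
qed

text \<open>
  The two triangles cut off by the cevian from \<open>0\<close> to \<open>D\<close> have convex union, so their Minkowski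
  sum is that of their union \<open>T\<close> and their intersection \<open>[0, D]\<close>.
\<close>

lemma cevian_parameter_eq:
  assumes BC: "cross2 B C \<noteq> 0" and s: "0 < s" "s < 1"
    and good: "linear_defect c (convex hull {0, B, C})" "linear_defect a (convex hull {0, B, (1 - s) *\<^sub>R B + s *\<^sub>R C})"
  shows "a = c"
proof -
  define D where "D = (1 - s) *\<^sub>R B + s *\<^sub>R C"
  have "cross2 D C = (1 - s) * cross2 B C"
    by (simp add: D_def cross2_def algebra_simps)
  then have "cross2 D C \<noteq> 0"
    using BC s by simp
  \<comment> \<open>The second piece has a parameter of its own, which is eliminated together with
    the linear terms.\<close>
  then obtain b where b: "linear_defect b (convex hull {0, D, C})"
    using triangle_linear_defect by blast
  obtain u v where uv: "\<And>x y. N (x *\<^sub>R u + y *\<^sub>R v) \<bullet> B = x" "\<And>x y. N (x *\<^sub>R u + y *\<^sub>R v) \<bullet> C = y"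
    "\<And>w. w = (N w \<bullet> B) *\<^sub>R u + (N w \<bullet> C) *\<^sub>R v"
    by (rule dual_basis_N[OF BC], blast)
  define n where "n x y = x *\<^sub>R u + y *\<^sub>R v" for x y
  have nD: "N (n x y) \<bullet> D = (1 - s) * x + s * y" for x y
    by (simp add: D_def n_def uv inner_add_right)
  note nN = uv(1,2)[folded n_def] nD
  have bound: "max (w \<bullet> B) (w \<bullet> C) \<ge> w \<bullet> D" "min (w \<bullet> B) (w \<bullet> C) \<le> w \<bullet> D" for w
  proof -
    show "max (w \<bullet> B) (w \<bullet> C) \<ge> w \<bullet> D"
      unfolding D_def inner_add_right inner_scaleR_right using s by (intro convex_bound_le) auto
    have "(- w) \<bullet> D \<le> max ((- w) \<bullet> B) ((- w) \<bullet> C)"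
      unfolding D_def inner_add_right inner_scaleR_right using s by (intro convex_bound_le) auto
    then show "min (w \<bullet> B) (w \<bullet> C) \<le> w \<bullet> D"
      by (simp add: max_def min_def split: if_splits)
  qed
  have "convex hull {0, B, D} + convex hull {0, D, C} = convex hull {0, B, C} + closed_segment 0 D"
  proof (intro convex_body_eqI)
    show "support_function (convex hull {0, B, D} + convex hull {0, D, C}) w
        = support_function (convex hull {0, B, C} + closed_segment 0 D) w" for w
      using bound[of w]
      by (simp add: support_plus support_triangle support_segment max_def min_def split: if_splits)
  qed auto
  then have eq: "support_function (\<Phi> (convex hull {0, B, D})) w + support_function (\<Phi> (convex hull {0, D, C})) w
      = support_function (\<Phi> (convex hull {0, B, C})) w + support_function (\<Phi> (closed_segment 0 D)) w" for w
    by (metis plus support_plus body convex_body_hull convex_body_segment finite.emptyI finite.insertI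
        insert_not_empty)
  \<comment> \<open>By the cutting identity the terms with \<Phi> cancel in \<open>f\<close>. What
    remains is a relation between support functions of triangles and of the cevian whose value is
    linear; parameter \<open>1 / 2\<close> turns the cevian term into \<open>1 / 2\<close> times an
    absolute value.\<close>
  define f where "f w = defect c (convex hull {0, B, C}) w + defect (1 / 2) (closed_segment 0 D) w
      - defect a (convex hull {0, B, D}) w - defect b (convex hull {0, D, C}) w" for w
  have "linear f"
    unfolding f_def using good b linear_defect_segment[of "1 / 2" 0 D]
    by (intro linear_compose_add linear_compose_sub) (simp_all add: linear_defect_def D_def)
  then have fn: "f (n x y) = f u * x + f v * y" for x y
    by (simp add: n_def linear_add linear_cmul)
  show ?thesis
  proof (rule cevian_coefficients_eq[OF s, where b = b and n = "1 / 2" and l = "f u" and m = "f v"])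
    show "(a * max 0 (max x ((1 - s) * x + s * y)) + (1 - a) * max 0 (max (- x) (- ((1 - s) * x + s * y))))
        + (b * max 0 (max ((1 - s) * x + s * y) y) + (1 - b) * max 0 (max (- ((1 - s) * x + s * y)) (- y)))
      = (c * max 0 (max x y) + (1 - c) * max 0 (max (- x) (- y)))
        + 1 / 2 * \<bar>(1 - s) * x + s * y\<bar> + f u * x + f v * y" for x y
    proof -
      have half: "(1 / 2) * max 0 z + (1 - 1 / 2) * max 0 (- z) = 1 / 2 * \<bar>z\<bar>" for z :: real
        by (simp add: max_def abs_if)
      show ?thesis
        using eq[of "n x y"] fn[of x y] half[of "(1 - s) * x + s * y"]
        unfolding f_def defect_def support_triangle support_segment inner_zero_right inner_minus_left nN
        by linarith
    qed
  qed
qed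

section \<open>One parameter for all triangles\<close>

text \<open>Each of the two triangles has some parameter, and by \<open>cevian_parameter_eq\<close>
  a parameter of one equals any parameter of the other; this gives both directions.\<close>

lemma linear_defect_cevian:
  assumes ABC: "cross2 (B - A) (C - A) \<noteq> 0" and s: "0 < s" "s < 1"
  shows "linear_defect a (convex hull {A, B, (1 - s) *\<^sub>R B + s *\<^sub>R C}) \<longleftrightarrow> linear_defect a (convex hull {A, B, C})"
proof -
  define b c d where "b = B - A" and "c = C - A" and "d = (1 - s) *\<^sub>R b + s *\<^sub>R c"
  have d: "(1 - s) *\<^sub>R B + s *\<^sub>R C - A = d"
    by (simp add: b_def c_def d_def algebra_simps)
  have tr: "linear_defect a (convex hull {A, X, Y}) \<longleftrightarrow> linear_defect a (convex hull {0, X - A, Y - A})" for a X Y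
    unfolding triangle_translate[of A] by (rule linear_defect_translation) simp
  have bc: "cross2 b c \<noteq> 0"
    using ABC by (simp add: b_def c_def)
  have "cross2 b d = s * cross2 b c"
    by (simp add: d_def cross2_def algebra_simps)
  then have bd: "cross2 b d \<noteq> 0"
    using bc s by simp
  obtain a1 where a1: "linear_defect a1 (convex hull {0, b, c})"
    using triangle_linear_defect[OF bc] by blast
  obtain a2 where a2: "linear_defect a2 (convex hull {0, b, d})"
    using triangle_linear_defect[OF bd] by blast
  show ?thesis
    unfolding tr d b_def[symmetric] c_def[symmetric]
    using cevian_parameter_eq[OF bc s, folded d_def] a1 a2 by metis
qed

text \<open>For \<open>s < 1\<close> the new vertex is the foot of a cevian from \<open>B\<close>;
  for \<open>s > 1\<close> the old vertex \<open>C\<close> is such a foot in the new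
  triangle.\<close>

lemma linear_defect_move:
  assumes ABC: "cross2 (B - A) (C - A) \<noteq> 0" and s: "0 < s"
    and good: "linear_defect a (convex hull {A, B, C})"
  shows "linear_defect a (convex hull {A, B, A + s *\<^sub>R (C - A)})"
proof -
  have perm: "{A, B, X} = {B, A, X}" for X
    by auto
  have cross: "cross2 (A - B) (C - B) = - cross2 (B - A) (C - A)"
    by (simp add: cross2_def algebra_simps)
  consider "s < 1" | "s = 1" | "1 < s"
    by linarith
  then show ?thesis
  proof cases
    case 1
    have "A + s *\<^sub>R (C - A) = (1 - s) *\<^sub>R A + s *\<^sub>R C"
      by (simp add: algebra_simps)
    then show ?thesis
      using linear_defect_cevian[of A B C s a] cross ABC s 1 good unfolding perm by simp
  next
    case 2
    then show ?thesis
      using good by simp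
  next
    case 3
    define D where "D = A + s *\<^sub>R (C - A)"
    have C: "(1 - 1 / s) *\<^sub>R A + (1 / s) *\<^sub>R D = C"
      using s by (simp add: D_def algebra_simps)
    have "cross2 (A - B) (D - B) = - s * cross2 (B - A) (C - A)"
      by (simp add: D_def cross2_def algebra_simps)
    then show ?thesis
      using linear_defect_cevian[of A B D "1 / s" a] ABC s 3 good unfolding perm C D_def[symmetric] by simp
  qed
qed

lemma linear_defect_ccw_triangle:
  assumes good: "linear_defect a (convex hull {0, axis 1 1, axis 2 1})" and BC: "0 < cross2 B C"
  shows "linear_defect a (convex hull {0, B, C})"
proof -
  obtain \<rho> \<theta> where \<rho>: "0 \<le> \<rho>" "B = \<rho> *\<^sub>R circle_point \<theta>"
    by (rule polar_real2)
  have \<rho>0: "0 < \<rho>"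
    using \<rho> BC by (cases "\<rho> = 0") (auto simp: cross2_def)
  define e :: "real^2" where "e = axis 1 1"
  have e: "e $ 1 = 1" "e $ 2 = 0"
    by (simp_all add: e_def axis_def)
  \<comment> \<open>After this turn \<open>B\<close> lies on the positive first axis and
    \<open>C\<close> above it.\<close>
  define c where "c = rot (- \<theta>) *v C"
  have "cross2 B C = \<rho> * c $ 2"
    using cross2_rot[of "- \<theta>" B C]
    by (simp add: c_def \<rho>(2) matrix_vector_mult_scaleR rot_circle_point cross2_def)
  then have c2: "0 < c $ 2"
    using BC \<rho>0 by (simp add: zero_less_mult_iff)
  \<comment> \<open>Shrinks \<open>c\<close> until its first coordinate is below \<open>1\<close>,
    the first coordinate of \<open>e\<close>, so that the line from \<open>e\<close> through
    \<open>\<tau> c\<close> meets the second axis at a positive height.\<close>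
  define \<tau> where "\<tau> = 1 / (1 + \<bar>c $ 1\<bar>)"
  have \<tau>: "0 < \<tau>"
    by (simp add: \<tau>_def add_pos_nonneg)
  have "c $ 1 < 1 + \<bar>c $ 1\<bar>" "0 < 1 + \<bar>c $ 1\<bar>"
    by linarith+
  then have xt: "0 < 1 - \<tau> * c $ 1"
    by (simp add: \<tau>_def divide_less_eq_1)
  \<comment> \<open>That height: sliding the vertex \<open>h *\<^sub>R axis 2 1\<close> along its
    line to \<open>e\<close> reaches \<open>\<tau> *\<^sub>R c\<close>.\<close>
  define h where "h = \<tau> * c $ 2 / (1 - \<tau> * c $ 1)"
  have h: "0 < h"
    using xt \<tau> c2 by (simp add: h_def)
  have 1: "linear_defect a (convex hull {0, e, h *\<^sub>R axis 2 1})"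
    using linear_defect_move[of e 0 "axis 2 1" h a] good h by (simp add: e_def cross2_def axis_def)
  have eq: "e + (1 - \<tau> * c $ 1) *\<^sub>R (h *\<^sub>R axis 2 1 - e) = \<tau> *\<^sub>R c"
    using xt by (simp add: real2_eq_iff e axis_def h_def)
  have 2: "linear_defect a (convex hull {0, e, \<tau> *\<^sub>R c})"
    using linear_defect_move[of 0 e "h *\<^sub>R axis 2 1" "1 - \<tau> * c $ 1" a] 1 xt h
    unfolding eq by (simp add: insert_commute cross2_def axis_def e)
  have 3: "linear_defect a (convex hull {0, e, c})"
    using linear_defect_move[of e 0 "\<tau> *\<^sub>R c" "1 / \<tau>" a] 2 \<tau> c2 by (simp add: cross2_def e)
  have 4: "linear_defect a (convex hull {0, \<rho> *\<^sub>R e, c})"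
    using linear_defect_move[of c 0 e \<rho> a] 3 \<rho>0 c2 by (simp add: cross2_def e insert_commute)
  have "linear_defect a ((*v) (rot \<theta>) ` (convex hull {0, \<rho> *\<^sub>R e, c}))"
    by (rule linear_defect_rot[OF _ 4]) simp
  moreover have "rot \<theta> *v (\<rho> *\<^sub>R e) = B"
    by (simp add: \<rho>(2) real2_eq_iff e)
  moreover have "rot \<theta> *v c = C"
    by (simp add: c_def rot_rot rot_zero)
  ultimately show ?thesis
    by (simp add: matrix_triangle)
qed

lemma linear_defect_triangle:
  assumes good: "linear_defect a (convex hull {0, axis 1 1, axis 2 1})"
    and ABC: "cross2 (B - A) (C - A) \<noteq> 0"
  shows "linear_defect a (convex hull {A, B, C})"
proof -
  have "linear_defect a (convex hull {0, B - A, C - A})"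
  proof (cases "0 < cross2 (B - A) (C - A)")
    case True
    then show ?thesis
      by (rule linear_defect_ccw_triangle[OF good])
  next
    case False
    moreover have "cross2 (C - A) (B - A) = - cross2 (B - A) (C - A)"
      by (simp add: cross2_def)
    ultimately have "0 < cross2 (C - A) (B - A)"
      using ABC by linarith
    then show ?thesis
      using linear_defect_ccw_triangle[OF good, of "C - A" "B - A"]
      by (simp add: insert_commute[of "C - A" "B - A"])
  qed
  then show ?thesis
    unfolding triangle_translate[of A] by (simp add: linear_defect_translation)
qed

section \<open>From triangles to all convex bodies\<close>

text \<open>Induction on the number of points. Dropping points in the hull of the others secures
  convex position; from four points on a diagonal leaves two smaller sets and a segment, whose
  defect is linear for any \<open>a\<close>.\<close>

lemma linear_defect_polygon:
  assumes good: "linear_defect a (convex hull {0, axis 1 1, axis 2 1})"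
    and "finite V" "V \<noteq> {}"
  shows "linear_defect a (convex hull V)"
  using assms(2,3)
proof (induction "card V" arbitrary: V rule: less_induct)
  case less
  note fin = less.prems(1)
  show ?case
  proof (cases "\<exists>x\<in>V. x \<in> convex hull (V - {x})")
    case True
    then obtain x where x: "x \<in> V" "x \<in> convex hull (V - {x})"
      by blast
    have "convex hull V = convex hull (V - {x})"
      using hull_redundant[OF x(2)] x(1) by (simp add: insert_absorb)
    moreover have "V - {x} \<noteq> {}"
      using x(2) by (metis convex_hull_empty empty_iff)
    moreover have "card (V - {x}) < card V"
      by (rule card_Diff1_less[OF fin x(1)])
    ultimately show ?thesis
      using less.hyps[of "V - {x}"] fin by simp
  next
    case False
    then have cp: "\<And>x. x \<in> V \<Longrightarrow> x \<notin> convex hull (V - {x})"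
      by blast
    consider "card V = 1" | "card V = 2" | "card V = 3" | "4 \<le> card V"
      using less.prems card_0_eq[of V] by arith
    then show ?thesis
    proof cases
      case 1
      then obtain p where "V = {p}"
        by (rule card_1_singletonE)
      then show ?thesis
        using linear_defect_segment[of a p p] by simp
    next
      case 2
      then obtain p q where "V = {p, q}"
        by (auto simp: card_2_iff)
      then show ?thesis
        using linear_defect_segment[of a p q] by (simp add: segment_convex_hull)
    next
      case 3
      then obtain p q x where V: "V = {p, q, x}" "p \<noteq> q" "q \<noteq> x" "p \<noteq> x"
        by (auto simp: card_3_iff)
      then have "cross2 (q - p) (x - p) \<noteq> 0"
        by (intro cross2_neq_0_of_convex_position[OF cp]) auto
      then show ?thesis
        using linear_defect_triangle[OF good] V by simp
    next
      case 4
      obtain V1 V2 p q where V: "V1 \<subset> V" "V2 \<subset> V" "V1 \<noteq> {}" "V2 \<noteq> {}"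
        and eq: "convex hull V1 + convex hull V2 = convex hull V + closed_segment p q"
        by (rule convex_position_split[OF cp fin 4], blast)
      have fin12: "finite V1" "finite V2"
        using V fin finite_subset by blast+
      have "linear_defect a (convex hull V1)" "linear_defect a (convex hull V2)"
        using less.hyps[OF psubset_card_mono[OF fin V(1)] fin12(1) V(3)]
          less.hyps[OF psubset_card_mono[OF fin V(2)] fin12(2) V(4)] by blast+
      moreover have "defect a (convex hull V) = (\<lambda>u. defect a (convex hull V1) u
          + defect a (convex hull V2) u - defect a (closed_segment p q) u)"
        using arg_cong[OF eq, of "defect a"] fin fin12 V less.prems
        by (simp add: fun_eq_iff defect_plus)
      ultimately show ?thesis
        using linear_defect_segment[of a p q] unfolding linear_defect_def
        by (simp add: linear_compose_add linear_compose_sub)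
    qed
  qed
qed

text \<open>Defects converge pointwise, and a pointwise limit of linear functionals is
  linear.\<close>

lemma linear_defect_limit:
  assumes K: "K \<in> convex_bodies" and A: "\<And>n. A n \<in> convex_bodies" "\<And>n. linear_defect a (A n)"
    and e: "e \<longlonglongrightarrow> 0" "\<And>n. hausdorff_dist (A n) K \<le> e n"
  shows "linear_defect a K"
proof -
  have diff: "\<bar>support_function (A n) u - support_function K u\<bar> \<le> norm u * e n" for n u
    using support_le_hausdorff_dist[OF A(1) K, of n u] mult_left_mono[OF e(2)[of n], of "norm u"]
    by simp
  have supp: "(\<lambda>n. support_function (A n) u) \<longlonglongrightarrow> support_function K u" for u
  proof (rule LIM_zero_cancel, rule Lim_null_comparison)
    show "\<forall>\<^sub>F n in sequentially. norm (support_function (A n) u - support_function K u) \<le> norm u * e n"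
      using diff by simp
    show "(\<lambda>n. norm u * e n) \<longlonglongrightarrow> 0"
      using tendsto_mult_right_zero[OF e(1)] .
  qed
  have image: "(\<lambda>n. support_function (\<Phi> (A n)) u) \<longlonglongrightarrow> support_function (\<Phi> K) u" for u
  proof (rule tendsto_support[OF K A(1) _ e(1)], intro always_eventually allI impI)
    show "\<bar>support_function (A n) v - support_function K v\<bar> \<le> e n" if "norm v = 1" for n v
      using diff[of n v] that by simp
  qed
  have lim: "(\<lambda>n. defect a (A n) u) \<longlonglongrightarrow> defect a K u" for u
    unfolding defect_def by (intro tendsto_intros supp image)
  have lin: "linear (defect a (A n))" for n
    using A(2) by (simp add: linear_defect_def)
  have "linear (defect a K)"
  proof (rule linearI)
    show "defect a K (u + v) = defect a K u + defect a K v" for u v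
      using LIMSEQ_unique[OF lim[of "u + v"]] tendsto_add[OF lim[of u] lim[of v]]
      by (simp add: linear_add[OF lin])
    show "defect a K (c *\<^sub>R u) = c *\<^sub>R defect a K u" for c u
      using LIMSEQ_unique[OF lim[of "c *\<^sub>R u"]] tendsto_scaleR[OF tendsto_const lim[of u], of c]
      by (simp add: linear_cmul[OF lin])
  qed
  then show ?thesis
    by (simp add: linear_defect_def)
qed

lemma linear_defect_all:
  obtains a where "0 \<le> a" "a \<le> 1" "\<And>K. K \<in> convex_bodies \<Longrightarrow> linear_defect a K"
proof -
  have "cross2 (axis 1 1) (axis 2 1) \<noteq> 0"
    by (simp add: cross2_def axis_def)
  then obtain a where a: "0 \<le> a" "a \<le> 1" "linear_defect a (convex hull {0, axis 1 1, axis 2 1})"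
    by (rule triangle_linear_defect)
  have "linear_defect a K" if K: "K \<in> convex_bodies" for K
  proof -
    have "\<exists>V. finite V \<and> V \<noteq> {} \<and> hausdorff_dist (convex hull V) K \<le> 1 / real (Suc n)" for n
      by (rule convex_body_polygon_approx[OF K, of "1 / real (Suc n)"]) auto
    then obtain V where "\<And>n. finite (V n)" "\<And>n. V n \<noteq> {}"
      "\<And>n. hausdorff_dist (convex hull V n) K \<le> 1 / real (Suc n)"
      by metis
    then show ?thesis
      using linear_defect_polygon[OF a(3)] LIMSEQ_Suc[OF lim_1_over_n]
      by (intro linear_defect_limit[OF K, of "\<lambda>n. convex hull V n" a "\<lambda>n. 1 / real (Suc n)"]) auto
  qed
  then show thesis
    using that a by blast
qed

text \<open>The coefficients are \<open>r a\<close> and \<open>r (1 - a)\<close>, with sum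
  \<open>r\<close>. The linear defect is the support function of a point, so \<Phi> \<open>K\<close>
  is a translate by \<open>t\<close> of the combination \<open>M\<close> of centred bodies; both
  have Steiner point \<open>0\<close>, hence \<open>t = 0\<close>.\<close>

lemma support_image:
  obtains a b where "0 \<le> a" "0 \<le> b" "0 < a + b"
    "\<And>K u. K \<in> convex_bodies \<Longrightarrow> support_function (\<Phi> K) u
      = a * support_function ((*v) (rot \<phi>) ` (\<lambda>x. x - steiner_point K) ` K) u
      + b * support_function ((*v) (rot \<phi>) ` (\<lambda>x. - x + steiner_point K) ` K) u"
proof -
  obtain a where a: "0 \<le> a" "a \<le> 1" "\<And>K. K \<in> convex_bodies \<Longrightarrow> linear_defect a K"
    using linear_defect_all by blast
  have "support_function (\<Phi> K) u
      = (r * a) * support_function ((*v) (rot \<phi>) ` (\<lambda>x. x - steiner_point K) ` K) u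
      + (r * (1 - a)) * support_function ((*v) (rot \<phi>) ` (\<lambda>x. - x + steiner_point K) ` K) u"
    if K: "K \<in> convex_bodies" for K u
  proof -
    define L where "L = (*v) (rot \<phi>) ` (\<lambda>x. x + - steiner_point K) ` K"
    have L: "L \<in> convex_bodies"
      unfolding L_def by (intro convex_body_matrix convex_body_translation K)
    have stL: "steiner_point L = 0"
    proof -
      have "steiner_point ((\<lambda>x. x + - steiner_point K) ` K) = 1 *\<^sub>R steiner_point K + 1 *\<^sub>R steiner_point {- steiner_point K}"
        by (intro steiner_eqI convex_body_translation K)
           (simp_all only: support_translation[OF K] support_singleton convex_body_singleton)
      then have "steiner_point ((\<lambda>x. x + - steiner_point K) ` K) = 0"
        by (simp add: steiner_singleton)
      then show ?thesis
        unfolding L_def steiner_rot[OF convex_body_translation[OF K]] by simp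
    qed
    have L': "(*v) (rot \<phi>) ` (\<lambda>x. - x + steiner_point K) ` K = uminus ` L"
      unfolding L_def image_image by (intro image_cong) (auto simp: real2_eq_iff algebra_simps)
    have supL: "support_function K (N v) = r * support_function L v + N v \<bullet> steiner_point K" for v
      using r_pos
      by (simp only: L_def support_matrix transpose_rot support_translation[OF K] N_def
          support_homogeneous[OF K less_imp_le]) (simp add: algebra_simps)
    have "linear (defect a K)"
      using a(3)[OF K] by (simp add: linear_defect_def)
    then obtain s where s: "\<And>u. defect a K u = u \<bullet> s"
      by (rule linear_eq_inner) blast
    \<comment> \<open>The defect vector \<open>s\<close> plus the shift caused by moving the Steiner
      point of \<open>K\<close> to the origin.\<close>
    define t where "t = s + (2 * a - 1) *\<^sub>R (r *\<^sub>R (rot \<phi> *v steiner_point K))"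
    have supPhi: "support_function (\<Phi> K) v = (r * a) * support_function L v
        + (r * (1 - a)) * support_function (uminus ` L) v + v \<bullet> t" for v
      using s[of v] supL[of v] supL[of "- v"]
      unfolding defect_def t_def support_uminus N_simps(3) inner_N inner_add_right inner_minus_left
        inner_scaleR_right
      by (simp add: algebra_simps)
    define M where "M = (*\<^sub>R) (r * a) ` L + (*\<^sub>R) (r * (1 - a)) ` uminus ` L"
    have M: "M \<in> convex_bodies"
      unfolding M_def using L by auto
    have nonneg: "0 \<le> r * a" "0 \<le> r * (1 - a)"
      using a r_pos by simp_all
    have supM: "support_function M v = (r * a) * support_function L v
        + (r * (1 - a)) * support_function (uminus ` L) v" for v
      unfolding M_def using L nonneg
      by (simp add: support_plus support_scaleR support_homogeneous)
    have "steiner_point (uminus ` L) = 0"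
      using steiner_rot[OF L, of pi] stL by (simp add: rot_pi cong: image_cong)
    then have "steiner_point M = (r * a) *\<^sub>R 0 + (r * (1 - a)) *\<^sub>R 0"
      using steiner_eqI[OF M L convex_body_uminus[OF L] supM] stL by simp
    moreover have "steiner_point (\<Phi> K) = 1 *\<^sub>R steiner_point M + 1 *\<^sub>R steiner_point {t}"
      using K M by (intro steiner_eqI) (auto simp: supPhi supM support_singleton)
    ultimately have "t = 0"
      by (simp add: steiner_image[OF K] steiner_singleton)
    then show ?thesis
      using supPhi[of u] unfolding L' by (simp add: L_def)
  qed
  moreover have "0 \<le> r * a" "0 \<le> r * (1 - a)" "0 < r * a + r * (1 - a)"
    using a r_pos by (simp_all add: algebra_simps)
  ultimately show thesis
    by (rule that[rotated 3])
qed

end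

subsection \<open>Area of sums of a body and its reflection\<close>

lemma area_orthogonal:
  fixes g :: "real^2^2"
  assumes "orthogonal_matrix g" "K \<in> convex_bodies"
  shows "area ((*v) g ` K) = area K"
proof (rule measure_orthogonal_image)
  show "orthogonal_transformation ((*v) g)"
    using assms(1) by (simp add: orthogonal_transformation_matrix)
  show "K \<in> lmeasurable"
    using convex_bodyD(2)[OF assms(2)] by (rule lmeasurable_compact)
qed

lemma area_translation: "area ((\<lambda>x. x + t) ` K) = area K"
  using measure_translation[of t K] by (simp add: add.commute[of _ t])

lemma area_scaleR:
  assumes "K \<in> convex_bodies"
  shows "area ((*\<^sub>R) c ` K) = c\<^sup>2 * area K"
proof -
  have "area ((*\<^sub>R) c ` K) = \<bar>det (matrix ((*\<^sub>R) c) :: real^2^2)\<bar> * area K"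
    using lmeasurable_compact[OF convex_bodyD(2)[OF assms]]
    by (intro measure_linear_image) (simp_all add: linear_scaleR)
  then show ?thesis
    by (simp add: det_2 matrix_def axis_def power2_eq_square abs_mult)
qed

lemma area_mono:
  assumes "K \<in> convex_bodies" "L \<in> convex_bodies" "K \<subseteq> L"
  shows "area K \<le> area L"
  using assms(3) lmeasurable_compact[OF convex_bodyD(2)[OF assms(1)]]
    lmeasurable_compact[OF convex_bodyD(2)[OF assms(2)]]
  by (intro measure_mono_fmeasurable) (auto intro: fmeasurableD)

lemma area_le_plus:
  assumes "K \<in> convex_bodies" "L \<in> convex_bodies"
  shows "area K \<le> area (K + L)"
proof -
  obtain y where "y \<in> L"
    using convex_bodyD(1)[OF assms(2)] by blast
  then have "(\<lambda>x. x + y) ` K \<subseteq> K + L"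
    by (auto simp: set_plus_def)
  then have "area ((\<lambda>x. x + y) ` K) \<le> area (K + L)"
    using assms by (intro area_mono convex_body_plus convex_body_translation)
  then show ?thesis
    by (simp add: area_translation)
qed

text \<open>\<Phi> \<open>K\<close> is a rotated translate of this body in the target formula, so
  all area estimates can be made here.\<close>

definition reflection_sum :: "real \<Rightarrow> real \<Rightarrow> (real^2) set \<Rightarrow> (real^2) set" where
  "reflection_sum a b K = (*\<^sub>R) a ` K + (*\<^sub>R) b ` uminus ` K"

lemma convex_body_reflection_sum [intro, simp]:
  "K \<in> convex_bodies \<Longrightarrow> reflection_sum a b K \<in> convex_bodies"
  by (simp add: reflection_sum_def convex_body_plus convex_body_scaleR convex_body_uminus)

lemma support_reflection_sum:
  assumes "K \<in> convex_bodies" "0 \<le> a" "0 \<le> b"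
  shows "support_function (reflection_sum a b K) u = a * support_function K u + b * support_function K (- u)"
  unfolding reflection_sum_def support_weighted_sum[OF assms(1) convex_body_uminus[OF assms(1)] assms(2,3)]
    support_uminus ..

text \<open>The sum contains translates of \<open>a K\<close> and of \<open>b (- K)\<close>.
  Averaging the two bounds gives a constant that is positive as soon as one coefficient is
  nonzero.\<close>

lemma area_reflection_sum_ge:
  assumes K: "K \<in> convex_bodies"
  shows "(a\<^sup>2 + b\<^sup>2) / 2 * area K \<le> area (reflection_sum a b K)"
proof -
  have "area (uminus ` K) = area K"
    using area_scaleR[OF K, of "-1"] by (simp cong: image_cong)
  then have "a\<^sup>2 * area K \<le> area (reflection_sum a b K)" "b\<^sup>2 * area K \<le> area (reflection_sum a b K)"
    using area_le_plus[of "(*\<^sub>R) a ` K" "(*\<^sub>R) b ` uminus ` K"] K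
      area_le_plus[of "(*\<^sub>R) b ` uminus ` K" "(*\<^sub>R) a ` K"]
    by (simp_all add: reflection_sum_def area_scaleR add.commute)
  then show ?thesis
    by (simp add: algebra_simps)
qed

text \<open>
  If \<open>ABC\<close> has maximal area among the triangles in \<open>K\<close>, then \<open>K\<close> lies in the parallelogram
  centred at \<open>A\<close> with half axes \<open>B - A\<close> and \<open>C - A\<close>, whose area is eight times that of \<open>ABC\<close>.
\<close>

lemma max_area_triangle:
  assumes K: "K \<in> convex_bodies"
  obtains A B C where "A \<in> K" "B \<in> K" "C \<in> K"
    "\<And>X Y Z. X \<in> K \<Longrightarrow> Y \<in> K \<Longrightarrow> Z \<in> K \<Longrightarrow>
      \<bar>cross2 (Y - X) (Z - X)\<bar> \<le> \<bar>cross2 (B - A) (C - A)\<bar>"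
proof -
  let ?f = "\<lambda>p. \<bar>cross2 (fst (snd p) - fst p) (snd (snd p) - fst p)\<bar>"
  have K3: "compact (K \<times> K \<times> K)" "K \<times> K \<times> K \<noteq> {}"
    using convex_bodyD[OF K] by (auto intro: compact_Times)
  have "continuous_on (K \<times> K \<times> K) ?f"
    unfolding cross2_def by (intro continuous_intros)
  from continuous_attains_sup[OF K3 this]
  obtain p where p: "p \<in> K \<times> K \<times> K" "\<forall>q\<in>K \<times> K \<times> K. ?f q \<le> ?f p" ..
  show thesis
  proof (rule that)
    show "fst p \<in> K" "fst (snd p) \<in> K" "snd (snd p) \<in> K"
      using p(1) by auto
    show "\<bar>cross2 (Y - X) (Z - X)\<bar> \<le> ?f p" if "X \<in> K" "Y \<in> K" "Z \<in> K" for X Y Z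
      using bspec[OF p(2), of "(X, Y, Z)"] that by simp
  qed
qed

text \<open>The degenerate case without a triangle of positive area: a body on a line has its
  reflection sum on a parallel line, with normal \<open>n\<close>.\<close>

lemma area_reflection_sum_flat:
  assumes K: "K \<in> convex_bodies" and d: "d \<noteq> 0" "\<And>x. x \<in> K \<Longrightarrow> cross2 d x = m"
  shows "area (reflection_sum a b K) = 0"
proof -
  define n :: "real^2" where "n = vector [- (d $ 2), d $ 1]"
  have n: "n \<noteq> 0" "n \<bullet> x = cross2 d x" for x
    using d(1) by (auto simp: n_def real2_eq_iff inner_real2 cross2_def)
  have "reflection_sum a b K \<subseteq> {x. n \<bullet> x = (a - b) * m}"
  proof
    fix y assume "y \<in> reflection_sum a b K"
    then obtain x x' where y: "x \<in> K" "x' \<in> K" "y = a *\<^sub>R x + b *\<^sub>R (- x')"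
      by (auto simp: reflection_sum_def set_plus_def)
    have "n \<bullet> y = a * (n \<bullet> x) - b * (n \<bullet> x')"
      unfolding y(3) by (simp add: inner_simps)
    then show "y \<in> {x. n \<bullet> x = (a - b) * m}"
      using d(2)[OF y(1)] d(2)[OF y(2)] n(2)[of x] n(2)[of x'] by (simp add: algebra_simps)
  qed
  then have "negligible (reflection_sum a b K)"
    using n(1) negligible_hyperplane negligible_subset by blast
  then show ?thesis
    by (rule negligible_imp_measure0)
qed

text \<open>With \<open>K\<close> inside the parallelogram around \<open>A\<close>, the sum lies in
  its dilate by \<open>a + b\<close>, centred at \<open>(a - b) A\<close>. This has area
  \<open>4 (a + b)^2 |D|\<close>, and \<open>|D|\<close>, twice the area of \<open>ABC\<close>, is
  at most twice that of \<open>K\<close>.\<close>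

lemma area_reflection_sum_le:
  assumes K: "K \<in> convex_bodies" and ab: "0 \<le> a" "0 \<le> b"
  shows "area (reflection_sum a b K) \<le> 8 * (a + b)\<^sup>2 * area K"
proof -
  obtain A B C where ABC: "A \<in> K" "B \<in> K" "C \<in> K"
    and max: "\<And>X Y Z. X \<in> K \<Longrightarrow> Y \<in> K \<Longrightarrow> Z \<in> K \<Longrightarrow>
      \<bar>cross2 (Y - X) (Z - X)\<bar> \<le> \<bar>cross2 (B - A) (C - A)\<bar>"
    using max_area_triangle[OF K] by blast
  define D where "D = cross2 (B - A) (C - A)"
  show ?thesis
  proof (cases "D = 0")
    case True
    then have zero: "cross2 (Y - A) (Z - A) = 0" if "Y \<in> K" "Z \<in> K" for Y Z
      using max[OF ABC(1) that] by (simp add: D_def)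
    obtain d where d: "d \<noteq> 0" "\<And>x. x \<in> K \<Longrightarrow> cross2 d (x - A) = 0"
    proof (cases "K = {A}")
      case True
      then show thesis
        by (intro that[of "axis 1 1"]) (auto simp: cross2_def axis_eq_0_iff)
    next
      case False
      then obtain Y where "Y \<in> K" "Y \<noteq> A"
        using ABC(1) by blast
      then show thesis
        using zero by (intro that[of "Y - A"]) auto
    qed
    then have "cross2 d x = cross2 d A" if "x \<in> K" for x
      using d(2)[OF that] by (simp add: cross2_def algebra_simps)
    then have "area (reflection_sum a b K) = 0"
      by (rule area_reflection_sum_flat[OF K d(1)])
    then show ?thesis
      by simp
  next
    case False
    define f where "f z = z $ 1 *\<^sub>R (B - A) + z $ 2 *\<^sub>R (C - A)" for z :: "real^2"
    have lin: "linear f"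
      unfolding f_def by (intro linearI) (simp_all add: algebra_simps)
    have coord: "\<exists>z. x = A + f z \<and> \<bar>z $ 1\<bar> \<le> 1 \<and> \<bar>z $ 2\<bar> \<le> 1" if x: "x \<in> K" for x
    proof -
      \<comment> \<open>Cramer's rule: the coordinates are quotients of triangle areas, at most
        \<open>1\<close> in absolute value by maximality of \<open>ABC\<close>.\<close>
      define z :: "real^2" where
        "z = vector [cross2 (x - A) (C - A) / D, cross2 (B - A) (x - A) / D]"
      have "D *\<^sub>R f z = cross2 (x - A) (C - A) *\<^sub>R (B - A) + cross2 (B - A) (x - A) *\<^sub>R (C - A)"
        using False by (simp add: f_def z_def scaleR_add_right del: real2_eq_iff)
      also have "\<dots> = D *\<^sub>R (x - A)"
        by (simp add: real2_eq_iff D_def cross2_def) algebra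
      finally have "x = A + f z"
        using False by simp
      moreover have "\<bar>z $ 1\<bar> \<le> 1" "\<bar>z $ 2\<bar> \<le> 1"
        using max[OF ABC(1) x ABC(3)] max[OF ABC(1,2) x] False
        by (simp_all add: z_def D_def)
      ultimately show ?thesis
        by blast
    qed
    define s where "s = a + b"
    define Q :: "(real^2) set" where "Q = cbox (vector [- s, - s]) (vector [s, s])"
    have Qiff: "z \<in> Q \<longleftrightarrow> \<bar>z $ 1\<bar> \<le> s \<and> \<bar>z $ 2\<bar> \<le> s" for z
      unfolding Q_def by (auto simp: mem_box_cart forall_2)
    have Q0: "Q \<noteq> {}"
      using ab Qiff[of 0] by (auto simp: s_def)
    then have Q: "Q \<in> convex_bodies"
      by (auto simp: convex_bodies_def Q_def)
    have sub: "reflection_sum a b K \<subseteq> (\<lambda>x. x + (a - b) *\<^sub>R A) ` f ` Q"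
    proof
      fix y assume "y \<in> reflection_sum a b K"
      then obtain x x' where y: "x \<in> K" "x' \<in> K" "y = a *\<^sub>R x + b *\<^sub>R (- x')"
        by (auto simp: reflection_sum_def set_plus_def)
      obtain z where z: "x = A + f z" "\<bar>z $ 1\<bar> \<le> 1" "\<bar>z $ 2\<bar> \<le> 1"
        using coord[OF y(1)] by blast
      obtain z' where z': "x' = A + f z'" "\<bar>z' $ 1\<bar> \<le> 1" "\<bar>z' $ 2\<bar> \<le> 1"
        using coord[OF y(2)] by blast
      have bound: "\<bar>a * t - b * t'\<bar> \<le> s" if "\<bar>t\<bar> \<le> 1" "\<bar>t'\<bar> \<le> 1" for t t'
        using mult_left_mono[OF that(1) ab(1)] mult_left_mono[OF that(2) ab(2)]
          abs_triangle_ineq4[of "a * t" "b * t'"] ab by (simp add: abs_mult s_def)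
      have "a *\<^sub>R z - b *\<^sub>R z' \<in> Q"
        using bound z(2,3) z'(2,3) by (simp add: Qiff)
      moreover have "y = f (a *\<^sub>R z - b *\<^sub>R z') + (a - b) *\<^sub>R A"
        unfolding y(3) z(1) z'(1) linear_diff[OF lin] linear_cmul[OF lin] by (simp add: algebra_simps)
      ultimately show "y \<in> (\<lambda>x. x + (a - b) *\<^sub>R A) ` f ` Q"
        by blast
    qed
    have fQ: "f ` Q \<in> convex_bodies"
      by (rule convex_body_linear_image[OF Q lin])
    have "area (reflection_sum a b K) \<le> area ((\<lambda>x. x + (a - b) *\<^sub>R A) ` f ` Q)"
      using sub by (intro area_mono convex_body_reflection_sum K convex_body_translation fQ)
    also have "\<dots> = \<bar>det (matrix f)\<bar> * area Q"
      unfolding area_translation using convex_bodyD(2)[OF Q]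
      by (intro measure_linear_image lin lmeasurable_compact)
    also have "det (matrix f) = D"
      by (simp add: det_2 matrix_def f_def axis_def D_def cross2_def)
    also have "area Q = 4 * s\<^sup>2"
      using content_cbox_cart[OF Q0[unfolded Q_def]]
      by (simp add: Q_def UNIV_2 power2_eq_square)
    also have "\<bar>D\<bar> * (4 * s\<^sup>2) = 8 * s\<^sup>2 * (\<bar>D\<bar> / 2)"
      by simp
    also have "\<bar>D\<bar> / 2 = area (convex hull {A, B, C})"
    proof -
      have "closed (convex hull {A, B, C})"
        using convex_bodyD(5)[OF convex_body_hull[of "{A, B, C}"]] by simp
      then have "area (convex hull {A, B, C}) = measure lborel (convex hull {A, B, C})"
        by (simp add: measure_completion)
      also have "\<dots> = \<bar>- D\<bar> / 2"
        unfolding content_triangle by (simp add: D_def cross2_def algebra_simps)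
      finally show ?thesis
        by simp
    qed
    also have "8 * s\<^sup>2 * area (convex hull {A, B, C}) \<le> 8 * s\<^sup>2 * area K"
      using ABC convex_bodyD(3)[OF K] K
      by (intro mult_left_mono area_mono hull_minimal) auto
    finally show ?thesis
      by (simp add: s_def)
  qed
qed

lemma volume_comparable_reflection_sum:
  assumes ab: "0 \<le> a" "0 \<le> b" "0 < a + b"
    and area: "\<And>K. K \<in> convex_bodies \<Longrightarrow> area (\<Phi> K) = area (reflection_sum a b K)"
  shows "volume_comparable \<Phi>"
  unfolding volume_comparable_def
proof (intro exI conjI ballI)
  have "0 < a \<or> 0 < b"
    using ab by linarith
  then show "0 < (a\<^sup>2 + b\<^sup>2) / 2"
    by (auto simp: sum_power2_gt_zero_iff)
  show "0 < 8 * (a + b)\<^sup>2"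
    using ab(3) by simp
  show "(a\<^sup>2 + b\<^sup>2) / 2 * area K \<le> area (\<Phi> K)" if "K \<in> convex_bodies" for K
    using area_reflection_sum_ge[OF that] area[OF that] by simp
  show "area (\<Phi> K) \<le> 8 * (a + b)\<^sup>2 * area K" if "K \<in> convex_bodies" for K
    using area_reflection_sum_le[OF that ab(1,2)] area[OF that] by simp
qed

section \<open>The characterisations of (VC)\<close>

lemma convex_body_centred:
  fixes g :: "real^2^2"
  assumes "K \<in> convex_bodies"
  shows "(*v) g ` (\<lambda>x. x - t) ` K \<in> convex_bodies" "(*v) g ` (\<lambda>x. - x + t) ` K \<in> convex_bodies"
proof -
  have "(\<lambda>x. x - t) ` K = (\<lambda>x. x + - t) ` K" "(\<lambda>x. - x + t) ` K = (\<lambda>x. x + t) ` uminus ` K"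
    by (simp_all add: image_image)
  then show "(*v) g ` (\<lambda>x. x - t) ` K \<in> convex_bodies" "(*v) g ` (\<lambda>x. - x + t) ` K \<in> convex_bodies"
    using assms by (metis convex_body_matrix convex_body_translation convex_body_uminus)+
qed

lemma support_centred:
  fixes g :: "real^2^2"
  assumes K: "K \<in> convex_bodies"
  shows "support_function ((*v) g ` (\<lambda>x. x - t) ` K) u
      = support_function K (transpose g *v u) - (transpose g *v u) \<bullet> t" (is ?A)
    and "support_function ((*v) g ` (\<lambda>x. - x + t) ` K) u
      = support_function K (- (transpose g *v u)) + (transpose g *v u) \<bullet> t" (is ?B)
proof -
  have *: "(\<lambda>x. x - t) ` K = (\<lambda>x. x + - t) ` K" "(\<lambda>x. - x + t) ` K = (\<lambda>x. x + t) ` uminus ` K"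
    by (simp_all add: image_image)
  show ?A
    unfolding support_matrix * support_translation[OF K] by simp
  show ?B
    unfolding support_matrix * support_translation[OF convex_body_uminus[OF K]] support_uminus ..
qed

text \<open>The two summands are shifted by opposite vectors, so recentring at \<open>t\<close>
  amounts to one translation and leaves the area unchanged.\<close>

lemma centred_sum_eq_translate:
  fixes g :: "real^2^2"
  assumes K: "K \<in> convex_bodies" and ab: "0 \<le> a" "0 \<le> b"
  shows "(*\<^sub>R) a ` (*v) g ` (\<lambda>x. x - t) ` K + (*\<^sub>R) b ` (*v) g ` (\<lambda>x. - x + t) ` K
    = (\<lambda>x. x + (b - a) *\<^sub>R (g *v t)) ` (*v) g ` reflection_sum a b K"
proof (rule convex_body_eqI)
  have adj: "(transpose g *v u) \<bullet> t = u \<bullet> (g *v t)" for u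
    by (simp add: dot_lmul_matrix)
  show "support_function ((*\<^sub>R) a ` (*v) g ` (\<lambda>x. x - t) ` K + (*\<^sub>R) b ` (*v) g ` (\<lambda>x. - x + t) ` K) u
    = support_function ((\<lambda>x. x + (b - a) *\<^sub>R (g *v t)) ` (*v) g ` reflection_sum a b K) u" for u
  proof -
    have "support_function ((*\<^sub>R) a ` (*v) g ` (\<lambda>x. x - t) ` K + (*\<^sub>R) b ` (*v) g ` (\<lambda>x. - x + t) ` K) u
      = a * (support_function K (transpose g *v u) - u \<bullet> (g *v t))
        + b * (support_function K (- (transpose g *v u)) + u \<bullet> (g *v t))"
      unfolding support_weighted_sum[OF convex_body_centred[OF K] ab] support_centred[OF K] adj ..
    also have "\<dots> = support_function ((*v) g ` reflection_sum a b K) u + u \<bullet> ((b - a) *\<^sub>R (g *v t))"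
      unfolding support_matrix support_reflection_sum[OF K ab] inner_scaleR_right
      by (simp only: algebra_simps)
    finally show ?thesis
      by (simp only: support_translation convex_body_matrix convex_body_reflection_sum K)
  qed
qed (intro convex_body_plus convex_body_scaleR convex_body_centred convex_body_translation
    convex_body_matrix convex_body_reflection_sum K)+

lemma volume_comparable_iff:
  assumes endo: "minkowski_endomorphism \<Phi>"
  shows "volume_comparable \<Phi> \<longleftrightarrow>
    (\<exists>(g::real^2^2) a b. rotation_matrix g \<and> a \<ge> 0 \<and> b \<ge> 0 \<and> a + b > 0 \<and>
      (\<forall>K\<in>convex_bodies. \<Phi> K = (*\<^sub>R) a ` (*v) g ` (\<lambda>x. x - steiner_point K) ` K
        + (*\<^sub>R) b ` (*v) g ` (\<lambda>x. - x + steiner_point K) ` K))" (is "_ \<longleftrightarrow> ?form")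
proof
  assume vc: "volume_comparable \<Phi>"
  interpret minkowski_endo \<Phi>
    by standard (rule endo)
  obtain r \<phi> where "0 < r" "\<And>u v. support_function (\<Phi> (seg v)) u = r * \<bar>u \<bullet> (rot \<phi> *v v)\<bar>"
    using segment_images[OF vc] by blast
  then interpret segment_endo \<Phi> r \<phi>
    by unfold_locales
  obtain a b where ab: "0 \<le> a" "0 \<le> b" "0 < a + b"
    and supp: "\<And>K u. K \<in> convex_bodies \<Longrightarrow> support_function (\<Phi> K) u
      = a * support_function ((*v) (rot \<phi>) ` (\<lambda>x. x - steiner_point K) ` K) u
      + b * support_function ((*v) (rot \<phi>) ` (\<lambda>x. - x + steiner_point K) ` K) u"
    by (rule support_image, blast)
  have "\<Phi> K = (*\<^sub>R) a ` (*v) (rot \<phi>) ` (\<lambda>x. x - steiner_point K) ` K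
      + (*\<^sub>R) b ` (*v) (rot \<phi>) ` (\<lambda>x. - x + steiner_point K) ` K" if K: "K \<in> convex_bodies" for K
  proof (rule convex_body_eqI)
    show "support_function (\<Phi> K) u = support_function ((*\<^sub>R) a ` (*v) (rot \<phi>) ` (\<lambda>x. x - steiner_point K) ` K
      + (*\<^sub>R) b ` (*v) (rot \<phi>) ` (\<lambda>x. - x + steiner_point K) ` K) u" for u
      unfolding supp[OF K] support_weighted_sum[OF convex_body_centred[OF K] ab(1,2)] ..
  qed (intro body convex_body_plus convex_body_scaleR convex_body_centred K)+
  then show ?form
    using ab rotation_matrix_rot by blast
next
  assume ?form
  then obtain g :: "real^2^2" and a b where g: "rotation_matrix g" and ab: "0 \<le> a" "0 \<le> b" "0 < a + b"
    and eq: "\<And>K. K \<in> convex_bodies \<Longrightarrow> \<Phi> K = (*\<^sub>R) a ` (*v) g ` (\<lambda>x. x - steiner_point K) ` K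
      + (*\<^sub>R) b ` (*v) g ` (\<lambda>x. - x + steiner_point K) ` K"
    by blast
  have "area (\<Phi> K) = area (reflection_sum a b K)" if K: "K \<in> convex_bodies" for K
    unfolding eq[OF K] centred_sum_eq_translate[OF K ab(1,2)] area_translation
    using g K by (simp add: rotation_matrix_def area_orthogonal)
  then show "volume_comparable \<Phi>"
    by (rule volume_comparable_reflection_sum[OF ab])
qed

lemma convex_body_difference_body: "K \<in> convex_bodies \<Longrightarrow> difference_body K \<in> convex_bodies"
  by (simp add: difference_body_def)

lemma support_difference_body:
  "K \<in> convex_bodies \<Longrightarrow> support_function (difference_body K) u = support_function K u + support_function K (- u)"
  by (simp add: difference_body_def support_plus support_uminus)

lemma reflection_sum_difference_body:
  fixes g :: "real^2^2"
  assumes K: "K \<in> convex_bodies" and l: "0 \<le> l"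
  shows "(*\<^sub>R) l ` (*v) g ` difference_body K = (*v) g ` reflection_sum l l K"
proof (rule convex_body_eqI)
  show "support_function ((*\<^sub>R) l ` (*v) g ` difference_body K) u
      = support_function ((*v) g ` reflection_sum l l K) u" for u
    unfolding support_scaleR_nonneg[OF convex_body_matrix[OF convex_body_difference_body[OF K]] l]
      support_matrix support_difference_body[OF K] support_reflection_sum[OF K l l] distrib_left ..
qed (use K in \<open>auto simp: difference_body_def\<close>)

theorem theorem6p1:
  fixes \<Phi> :: "(real^2) set \<Rightarrow> (real^2) set"
  assumes "minkowski_endomorphism \<Phi>"
  shows "(volume_comparable \<Phi> \<longleftrightarrow>
            (\<exists>(g::real^2^2) (a::real) (b::real).
               rotation_matrix g \<and> a \<ge> 0 \<and> b \<ge> 0 \<and> a + b > 0 \<and>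
               (\<forall>K\<in>convex_bodies.
                  \<Phi> K = (*\<^sub>R) a ` (*v) g ` (\<lambda>x. x - steiner_point K) ` K
                      + (*\<^sub>R) b ` (*v) g ` (\<lambda>x. - x + steiner_point K) ` K)))
       \<and> ((\<forall>K\<in>convex_bodies. \<Phi> K = uminus ` \<Phi> K) \<longrightarrow>
            (volume_comparable \<Phi> \<longleftrightarrow>
               (\<exists>(l::real) (g::real^2^2).
                  l > 0 \<and> orthogonal_matrix g \<and>
                  (\<forall>K\<in>convex_bodies. \<Phi> K = (*\<^sub>R) l ` (*v) g ` difference_body K))))"
proof (intro conjI impI)
  show "volume_comparable \<Phi> \<longleftrightarrow>
    (\<exists>(g::real^2^2) (a::real) (b::real). rotation_matrix g \<and> a \<ge> 0 \<and> b \<ge> 0 \<and> a + b > 0 \<and>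
      (\<forall>K\<in>convex_bodies. \<Phi> K = (*\<^sub>R) a ` (*v) g ` (\<lambda>x. x - steiner_point K) ` K
        + (*\<^sub>R) b ` (*v) g ` (\<lambda>x. - x + steiner_point K) ` K))"
    by (rule volume_comparable_iff[OF assms])
  assume sym: "\<forall>K\<in>convex_bodies. \<Phi> K = uminus ` \<Phi> K"
  show "volume_comparable \<Phi> \<longleftrightarrow>
    (\<exists>(l::real) (g::real^2^2). l > 0 \<and> orthogonal_matrix g \<and>
      (\<forall>K\<in>convex_bodies. \<Phi> K = (*\<^sub>R) l ` (*v) g ` difference_body K))" (is "_ \<longleftrightarrow> ?form")
  proof
    assume "volume_comparable \<Phi>"
    then obtain g :: "real^2^2" and a b where g: "rotation_matrix g" and ab: "0 \<le> a" "0 \<le> b" "0 < a + b"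
      and eq: "\<And>K. K \<in> convex_bodies \<Longrightarrow> \<Phi> K = (*\<^sub>R) a ` (*v) g ` (\<lambda>x. x - steiner_point K) ` K
        + (*\<^sub>R) b ` (*v) g ` (\<lambda>x. - x + steiner_point K) ` K"
      unfolding volume_comparable_iff[OF assms] by blast
    \<comment> \<open>Symmetry allows averaging the support function of \<Phi> \<open>K\<close> over
      \<open>u\<close> and \<open>- u\<close>: the Steiner terms cancel and both coefficients become
      their mean.\<close>
    define l where "l = (a + b) / 2"
    have l: "0 < l"
      using ab(3) by (simp add: l_def)
    have "\<Phi> K = (*\<^sub>R) l ` (*v) g ` difference_body K" if K: "K \<in> convex_bodies" for K
    proof (rule convex_body_eqI)
      define t where "t = steiner_point K"
      have supp: "support_function (\<Phi> K) u = a * (support_function K (transpose g *v u) - (transpose g *v u) \<bullet> t)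
          + b * (support_function K (- (transpose g *v u)) + (transpose g *v u) \<bullet> t)" for u
        unfolding eq[OF K] t_def[symmetric] support_weighted_sum[OF convex_body_centred[OF K] ab(1,2)]
          support_centred[OF K] ..
      have neg: "transpose g *v (- u) = - (transpose g *v u)" for u
        using matrix_vector_mult_scaleR[of "transpose g" "-1" u] by simp
      show "support_function (\<Phi> K) u = support_function ((*\<^sub>R) l ` (*v) g ` difference_body K) u" for u
      proof -
        have "2 * support_function (\<Phi> K) u = support_function (\<Phi> K) u + support_function (\<Phi> K) (- u)"
          using bspec[OF sym K] support_uminus[of "\<Phi> K" u] by simp
        also have "\<dots> = (a + b) * (support_function K (transpose g *v u) + support_function K (- (transpose g *v u)))"
          unfolding supp neg by (simp add: algebra_simps)
        finally have "support_function (\<Phi> K) u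
            = l * (support_function K (transpose g *v u) + support_function K (- (transpose g *v u)))"
          by (simp add: l_def)
        then show ?thesis
          using l
          by (simp only: support_scaleR_nonneg[OF convex_body_matrix[OF convex_body_difference_body[OF K]] less_imp_le]
              support_matrix support_difference_body[OF K])
      qed
      show "\<Phi> K \<in> convex_bodies"
        using assms K by (simp add: minkowski_endomorphism_def)
      show "(*\<^sub>R) l ` (*v) g ` difference_body K \<in> convex_bodies"
        using K by (simp add: difference_body_def)
    qed
    then show ?form
      using l g by (auto simp: rotation_matrix_def)
  next
    assume ?form
    then obtain l and g :: "real^2^2" where l: "0 < l" "orthogonal_matrix g"
      and eq: "\<And>K. K \<in> convex_bodies \<Longrightarrow> \<Phi> K = (*\<^sub>R) l ` (*v) g ` difference_body K"
      by blast
    \<comment> \<open>\<open>l g (D K)\<close> is the image under \<open>g\<close> of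
      \<open>l K + l (- K)\<close>, and orthogonal maps preserve area.\<close>
    then show "volume_comparable \<Phi>"
      by (intro volume_comparable_reflection_sum[of l l])
         (simp_all add: reflection_sum_difference_body area_orthogonal)
  qed
qed

end
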